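(* Let $\Pi\in\mathcal M(G)$ have a nonsingular infinitesimal character $\lambda\in\mathbb C$, $\lambda\neq 0$. Assume that $\mathfrak Z(\mathfrak g_{\mathbb C})$ acts on each primary component $P_{\lambda+1}(\Pi\otimes\mathbb C^2)$ and $P_{\lambda-1}(\Pi\otimes\mathbb C^2)$ by scalars. Let $\varepsilon\in\{+,-\}$ (identified with $\{1,-1\}$ in formulas), $\delta\in\{1,-1\}$, and $\nu \in \mathbb C$. Let $T\colon\Pi\to\mathbb C_\nu$ be a symmetry breaking operator. Then, for every $u\in\Pi$, $$\bigl(T\otimes \operatorname{pr}_{\varepsilon}\bigr)\circ \operatorname{pr}_{\lambda\to\lambda+\delta}(u\otimes f_\varepsilon)=\frac{\lambda+\delta(1+\varepsilon\nu)}{2\lambda}\,(Tu)\otimes f_\varepsilon .$$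
   Context: $G\supset G'$ is a pair of real reductive Lie groups with complexified Lie algebras $(\mathfrak g_{\mathbb C},\mathfrak g'_{\mathbb C})=(\mathfrak{sl}(2,\mathbb C),\mathfrak{gl}(1,\mathbb C))$, with $G'$ connected. $\{H,X,Y\}\subset\mathfrak g_{\mathbb C}$ is an $\mathfrak{sl}_2$-triple ($[H,X]=2X$, $[H,Y]=-2Y$, $[X,Y]=H$) such that $\mathfrak g'_{\mathbb C}=\mathbb CH$. $\mathbb C_\nu$ is the one-dimensional representation of $\mathfrak g'_{\mathbb C}$ given by $tH\mapsto \nu t$, and the same notation is used for its lift to $G'$. $\mathcal M(G)$ is the category of admissible smooth Fréchet representations of $G$ of finite length and moderate growth. A symmetry breaking operator $T\colon\Pi\to\mathbb C_\nu$ is a continuous $G'$-homomorphism. Let $\Omega=H^2+2(XY+YX)$ be the Casimir element; $\mathfrak Z(\mathfrak g_{\mathbb C})=\mathbb C[\Omega]$ is the center of $U(\mathfrak g_{\mathbb C})$. The Harish-Chandra isomorphism $\operatorname{Hom}_{\mathbb C\text{-alg}}(\mathfrak Z(\mathfrak g_{\mathbb C}),\mathbb C)\simeq\mathbb C/\{\pm1\}$ is normalized so that infinitesimal character $\lambda$ means that $\Omega$ acts by $\lambda^2-1$. For $\tau\in\mathbb C$, $P_\tau(V)$ denotes the $\tau$-primary component of $V$, i.e. the generalized eigenspace of $\mathfrak Z(\mathfrak g_{\mathbb C})$ for the infinitesimal character $\tau$. $\mathbb C^2=\mathbb Cf_+\oplus\mathbb Cf_-$ is the natural representation of $\mathfrak{sl}(2,\mathbb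 C)$: $Hf_\pm=\pm f_\pm$, $Xf_+=Yf_-=0$, $Xf_-=f_+$, $Yf_+=f_-$. One has $\Pi\otimes\mathbb C^2=P_{\lambda+1}(\Pi\otimes\mathbb C^2)\oplus P_{\lambda-1}(\Pi\otimes\mathbb C^2)$ and $\operatorname{pr}_{\lambda\to\lambda+\delta}\colon\Pi\otimes\mathbb C^2\to P_{\lambda+\delta}(\Pi\otimes\mathbb C^2)$ is the corresponding projection. $\operatorname{pr}_\varepsilon\colon\mathbb C^2\to\mathbb Cf_\varepsilon$ is the projection along the other basis vector. *)

theory Defs
  imports "HOL-Analysis.Analysis" "HOL-Algebra.Group" "HOL-Computational_Algebra.Polynomial"
begin

section \<open>Smooth maps\<close>

text \<open>
  The class \<open>C\<^sup>k\<close> for maps from an open subset of a finite-dimensional space into a topological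
  vector space; \<open>sc\<close> is the multiplication by real scalars on the target.  The same definition
  serves charts (target a Euclidean space) and orbit maps (target a Frechet space).
\<close>

primrec Ck ::
  "(real \<Rightarrow> 'b \<Rightarrow> 'b) \<Rightarrow> nat \<Rightarrow> 'a::euclidean_space set \<Rightarrow> ('a \<Rightarrow> 'b::{topological_space,ab_group_add}) \<Rightarrow> bool"
where
  "Ck sc 0 S F \<longleftrightarrow> continuous_on S F"
| "Ck sc (Suc k) S F \<longleftrightarrow>
     (\<exists>D. (\<forall>x\<in>S. Vector_Spaces.linear (*\<^sub>R) sc (D x) \<and>
              ((\<lambda>h. sc (inverse (norm h)) (F (x + h) - F x - D x h)) \<longlongrightarrow> 0) (at 0)) \<and>
          (\<forall>h. Ck sc k S (\<lambda>x. D x h)))"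

definition smooth_on ::
  "(real \<Rightarrow> 'b \<Rightarrow> 'b) \<Rightarrow> 'a::euclidean_space set \<Rightarrow> ('a \<Rightarrow> 'b::{topological_space,ab_group_add}) \<Rightarrow> bool"
where
  "smooth_on sc S F \<longleftrightarrow> (\<forall>k. Ck sc k S F)"

text \<open>A chart is a pair of a domain and a coordinate map (irrelevant outside the domain).\<close>

type_synonym ('m, 'e) atlas = "('m set \<times> ('m \<Rightarrow> 'e)) set"

definition smooth_atlas :: "'m topology \<Rightarrow> ('m, 'e::euclidean_space) atlas \<Rightarrow> bool" where
  "smooth_atlas \<tau> \<A> \<longleftrightarrow>
     (\<forall>(U, \<phi>)\<in>\<A>. openin \<tau> U \<and> open (\<phi> ` U) \<and>
        homeomorphic_map (subtopology \<tau> U) (top_of_set (\<phi> ` U)) \<phi>) \<and>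
     (\<Union>(U, \<phi>)\<in>\<A>. U) = topspace \<tau> \<and>
     (\<forall>(U, \<phi>)\<in>\<A>. \<forall>(V, \<psi>)\<in>\<A>. smooth_on (*\<^sub>R) (\<phi> ` (U \<inter> V)) (\<psi> \<circ> inv_into U \<phi>))"

definition smooth_map ::
  "'m topology \<Rightarrow> ('m, 'e::euclidean_space) atlas \<Rightarrow> 'n topology \<Rightarrow> ('n, 'f::euclidean_space) atlas
     \<Rightarrow> ('m \<Rightarrow> 'n) \<Rightarrow> bool"
where
  "smooth_map \<tau> \<A> \<tau>' \<A>' f \<longleftrightarrow> continuous_map \<tau> \<tau>' f \<and>
     (\<forall>(U, \<phi>)\<in>\<A>. \<forall>(V, \<psi>)\<in>\<A>'. smooth_on (*\<^sub>R) (\<phi> ` (U \<inter> f -` V)) (\<psi> \<circ> f \<circ> inv_into U \<phi>))"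

definition prod_atlas ::
  "('m, 'e) atlas \<Rightarrow> ('n, 'f) atlas \<Rightarrow> ('m \<times> 'n, 'e \<times> 'f) atlas"
where
  "prod_atlas \<A> \<A>' = {(U \<times> V, map_prod \<phi> \<psi>) | U \<phi> V \<psi>. (U, \<phi>) \<in> \<A> \<and> (V, \<psi>) \<in> \<A>'}"

definition smooth_fun ::
  "(real \<Rightarrow> 'b \<Rightarrow> 'b) \<Rightarrow> ('m, 'e::euclidean_space) atlas \<Rightarrow> ('m \<Rightarrow> 'b::{topological_space,ab_group_add}) \<Rightarrow> bool"
where
  "smooth_fun sc \<A> f \<longleftrightarrow> (\<forall>(U, \<phi>)\<in>\<A>. smooth_on sc (\<phi> ` U) (f \<circ> inv_into U \<phi>))"

abbreviation smooth_real_fun :: "('m, 'e::euclidean_space) atlas \<Rightarrow> ('m \<Rightarrow> real) \<Rightarrow> bool" where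
  "smooth_real_fun \<A> f \<equiv> smooth_fun (*\<^sub>R) \<A> f"


section \<open>Lie groups and their Lie algebras\<close>

definition lie_group :: "'g monoid \<Rightarrow> 'g topology \<Rightarrow> ('g, 'e::euclidean_space) atlas \<Rightarrow> bool" where
  "lie_group G \<tau> \<A> \<longleftrightarrow>
     group G \<and> topspace \<tau> = carrier G \<and> Hausdorff_space \<tau> \<and> second_countable \<tau> \<and>
     smooth_atlas \<tau> \<A> \<and>
     smooth_map (prod_topology \<tau> \<tau>) (prod_atlas \<A> \<A>) \<tau> \<A> (\<lambda>(x, y). x \<otimes>\<^bsub>G\<^esub> y) \<and>
     smooth_map \<tau> \<A> \<tau> \<A> (\<lambda>x. inv\<^bsub>G\<^esub> x)"

text \<open>
  Left-invariant vector fields, i.e. derivations of the algebra of smooth real functions that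
  commute with left translations.  The first two conditions make \<open>D\<close> well defined on functions
  on the carrier (functions on the type may take junk values outside).
\<close>

definition left_invariant_derivation ::
  "'g monoid \<Rightarrow> ('g, 'e::euclidean_space) atlas \<Rightarrow> (('g \<Rightarrow> real) \<Rightarrow> 'g \<Rightarrow> real) \<Rightarrow> bool"
where
  "left_invariant_derivation G \<A> D \<longleftrightarrow>
     (\<forall>f. smooth_real_fun \<A> f \<longrightarrow> smooth_real_fun \<A> (D f)) \<and>
     (\<forall>f h. smooth_real_fun \<A> f \<longrightarrow> smooth_real_fun \<A> h \<longrightarrow> (\<forall>x\<in>carrier G. f x = h x) \<longrightarrow>
        (\<forall>x\<in>carrier G. D f x = D h x)) \<and>
     (\<forall>f h c. smooth_real_fun \<A> f \<longrightarrow> smooth_real_fun \<A> h \<longrightarrow> (\<forall>x\<in>carrier G.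
        D (\<lambda>y. f y + h y) x = D f x + D h x \<and>
        D (\<lambda>y. c * f y) x = c * D f x \<and>
        D (\<lambda>y. f y * h y) x = D f x * h x + f x * D h x)) \<and>
     (\<forall>f. smooth_real_fun \<A> f \<longrightarrow> (\<forall>a\<in>carrier G. \<forall>x\<in>carrier G.
        D (\<lambda>y. f (a \<otimes>\<^bsub>G\<^esub> y)) x = D f (a \<otimes>\<^bsub>G\<^esub> x)))"

type_synonym mat2 = "complex^2^2"

definition commutator :: "mat2 \<Rightarrow> mat2 \<Rightarrow> mat2" where
  "commutator A B = A ** B - B ** A"

definition cmat :: "complex \<Rightarrow> mat2 \<Rightarrow> mat2" where
  "cmat c A = (\<chi> i j. c * A $ i $ j)"

definition vector_field ::
  "'g monoid \<Rightarrow> (mat2 \<Rightarrow> 'g) \<Rightarrow> mat2 \<Rightarrow> ('g \<Rightarrow> real) \<Rightarrow> 'g \<Rightarrow> real"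
where
  "vector_field G ex A f x = deriv (\<lambda>t. f (x \<otimes>\<^bsub>G\<^esub> ex (t *\<^sub>R A))) 0"

text \<open>
  \<open>\<gg>\<close> is identified with the Lie algebra of \<open>G\<close>, with exponential map \<open>ex\<close>: every \<open>t \<mapsto> ex (t A)\<close>
  is a smooth one-parameter subgroup, and sending \<open>A\<close> to the left-invariant vector field it
  generates is an isomorphism of real Lie algebras from \<open>\<gg>\<close> onto all left-invariant vector fields.
\<close>

definition lie_algebra_of ::
  "'g monoid \<Rightarrow> 'g topology \<Rightarrow> ('g, 'e::euclidean_space) atlas \<Rightarrow> mat2 set \<Rightarrow> (mat2 \<Rightarrow> 'g) \<Rightarrow> bool"
where
  "lie_algebra_of G \<tau> \<A> \<gg> ex \<longleftrightarrow>
     subspace \<gg> \<and> (\<forall>A\<in>\<gg>. \<forall>B\<in>\<gg>. commutator A B \<in> \<gg>) \<and>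
     (\<forall>A\<in>\<gg>. smooth_map euclidean {(UNIV, \<lambda>t. t)} \<tau> \<A> (\<lambda>t::real. ex (t *\<^sub>R A)) \<and>
        (\<forall>s t. ex ((s + t) *\<^sub>R A) = ex (s *\<^sub>R A) \<otimes>\<^bsub>G\<^esub> ex (t *\<^sub>R A))) \<and>
     (\<forall>A\<in>\<gg>. \<forall>B\<in>\<gg>. \<forall>c. \<forall>f. smooth_real_fun \<A> f \<longrightarrow> (\<forall>x\<in>carrier G.
        vector_field G ex (A + B) f x = vector_field G ex A f x + vector_field G ex B f x \<and>
        vector_field G ex (c *\<^sub>R A) f x = c * vector_field G ex A f x \<and>
        vector_field G ex (commutator A B) f x =
          vector_field G ex A (vector_field G ex B f) x -
          vector_field G ex B (vector_field G ex A f) x)) \<and>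
     (\<forall>A\<in>\<gg>. left_invariant_derivation G \<A> (vector_field G ex A)) \<and>
     (\<forall>D. left_invariant_derivation G \<A> D \<longrightarrow>
        (\<exists>!A. A \<in> \<gg> \<and> (\<forall>f. smooth_real_fun \<A> f \<longrightarrow>
                              (\<forall>x\<in>carrier G. D f x = vector_field G ex A f x))))"

definition sl2 :: "mat2 set" where
  "sl2 = {Z. trace Z = 0}"

text \<open>\<open>\<gg> \<otimes> \<complex> = sl(2,\<complex>)\<close>:\<close>

definition real_form_sl2 :: "mat2 set \<Rightarrow> bool" where
  "real_form_sl2 \<gg> \<longleftrightarrow> \<gg> \<subseteq> sl2 \<and>
     (\<forall>Z\<in>sl2. \<exists>!(A, B). A \<in> \<gg> \<and> B \<in> \<gg> \<and> Z = A + cmat \<i> B)"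

text \<open>
  Reductivity in the sense of the Harish-Chandra class, for \<open>G\<close> with complexified Lie algebra
  \<open>sl(2,\<complex>)\<close>.  Of the defining conditions, reductivity of the Lie algebra is automatic, and so is
  that \<open>Ad(G)\<close> acts on \<open>sl(2,\<complex>)\<close> by inner automorphisms.  What remains is that \<open>G\<close> has finitely
  many components and that its identity component (which is also the analytic subgroup with
  Lie algebra \<open>[\<gg>,\<gg>]\<close>) has finite center.
\<close>

definition reductive_sl2_group ::
  "'g monoid \<Rightarrow> 'g topology \<Rightarrow> ('g, 'e::euclidean_space) atlas \<Rightarrow> mat2 set \<Rightarrow> (mat2 \<Rightarrow> 'g) \<Rightarrow> bool"
where
  "reductive_sl2_group G \<tau> \<A> \<gg> ex \<longleftrightarrow>
     lie_group G \<tau> \<A> \<and> lie_algebra_of G \<tau> \<A> \<gg> ex \<and> real_form_sl2 \<gg> \<and>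
     finite (connected_components_of \<tau>) \<and>
     (let G0 = connected_component_of_set \<tau> \<one>\<^bsub>G\<^esub> in
        finite {z \<in> G0. \<forall>x\<in>G0. z \<otimes>\<^bsub>G\<^esub> x = x \<otimes>\<^bsub>G\<^esub> z})"

definition Hmat :: mat2 where "Hmat = vector [vector [1, 0], vector [0, -1]]"
definition Xmat :: mat2 where "Xmat = vector [vector [0, 1], vector [0, 0]]"
definition Ymat :: mat2 where "Ymat = vector [vector [0, 0], vector [1, 0]]"

definition lie_subalgebra_of :: "mat2 set \<Rightarrow> (mat2 \<Rightarrow> 'g) \<Rightarrow> 'g set \<Rightarrow> mat2 set" where
  "lie_subalgebra_of \<gg> ex G' = {A \<in> \<gg>. \<forall>t::real. ex (t *\<^sub>R A) \<in> G'}"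

text \<open>\<open>G'\<close> is a connected closed subgroup whose complexified Lie algebra is \<open>\<complex>H\<close>.\<close>

definition gl1_subgroup ::
  "'g monoid \<Rightarrow> 'g topology \<Rightarrow> mat2 set \<Rightarrow> (mat2 \<Rightarrow> 'g) \<Rightarrow> 'g set \<Rightarrow> bool"
where
  "gl1_subgroup G \<tau> \<gg> ex G' \<longleftrightarrow>
     subgroup G' G \<and> closedin \<tau> G' \<and> connectedin \<tau> G' \<and>
     {A + cmat \<i> B | A B. A \<in> lie_subalgebra_of \<gg> ex G' \<and> B \<in> lie_subalgebra_of \<gg> ex G'}
       = range (\<lambda>c. cmat c Hmat)"

text \<open>The one-dimensional representation of \<open>G'\<close> whose differential is \<open>cH \<mapsto> \<nu>c\<close>.\<close>

definition lifts_character ::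
  "'g monoid \<Rightarrow> 'g topology \<Rightarrow> mat2 set \<Rightarrow> (mat2 \<Rightarrow> 'g) \<Rightarrow> 'g set \<Rightarrow> complex \<Rightarrow> ('g \<Rightarrow> complex) \<Rightarrow> bool"
where
  "lifts_character G \<tau> \<gg> ex G' \<nu> \<eta> \<longleftrightarrow>
     continuous_map (subtopology \<tau> G') euclidean \<eta> \<and> \<eta> \<one>\<^bsub>G\<^esub> = 1 \<and>
     (\<forall>x\<in>G'. \<forall>y\<in>G'. \<eta> (x \<otimes>\<^bsub>G\<^esub> y) = \<eta> x * \<eta> y) \<and>
     (\<forall>c. cmat c Hmat \<in> lie_subalgebra_of \<gg> ex G' \<longrightarrow>
        ((\<lambda>t::real. \<eta> (ex (t *\<^sub>R cmat c Hmat))) has_vector_derivative \<nu> * c) (at 0))"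


section \<open>The category of smooth representations\<close>

definition seminorm :: "(complex \<Rightarrow> 'v \<Rightarrow> 'v) \<Rightarrow> ('v::ab_group_add \<Rightarrow> real) \<Rightarrow> bool" where
  "seminorm smul p \<longleftrightarrow>
     (\<forall>u v. p (u + v) \<le> p u + p v) \<and> (\<forall>c u. p (smul c u) = cmod c * p u)"

text \<open>The Hausdorff property is part of the class \<open>t2_space\<close>.\<close>

definition frechet_space :: "(complex \<Rightarrow> 'v \<Rightarrow> 'v) \<Rightarrow> ('v::{t2_space,ab_group_add}) itself \<Rightarrow> bool" where
  "frechet_space smul t \<longleftrightarrow> vector_space smul \<and>
     (\<exists>p :: nat \<Rightarrow> 'v \<Rightarrow> real.
        (\<forall>k. seminorm smul (p k)) \<and>
        (\<forall>U. open U \<longleftrightarrow> (\<forall>x\<in>U. \<exists>n. \<exists>e>0. {y. \<forall>k\<le>n. p k (y - x) < e} \<subseteq> U)) \<and>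
        (\<forall>s. (\<forall>k. \<forall>e>0. \<exists>N. \<forall>m\<ge>N. \<forall>n\<ge>N. p k (s m - s n) < e) \<longrightarrow> (\<exists>l. s \<longlonglongrightarrow> l)))"

definition continuous_rep ::
  "(complex \<Rightarrow> 'v \<Rightarrow> 'v) \<Rightarrow> 'g monoid \<Rightarrow> 'g topology \<Rightarrow> ('g \<Rightarrow> 'v::{t2_space,ab_group_add} \<Rightarrow> 'v) \<Rightarrow> bool"
where
  "continuous_rep smul G \<tau> \<pi> \<longleftrightarrow>
     (\<forall>x\<in>carrier G. Vector_Spaces.linear smul smul (\<pi> x)) \<and>
     (\<forall>u. \<pi> \<one>\<^bsub>G\<^esub> u = u) \<and>
     (\<forall>x\<in>carrier G. \<forall>y\<in>carrier G. \<forall>u. \<pi> (x \<otimes>\<^bsub>G\<^esub> y) u = \<pi> x (\<pi> y u)) \<and>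
     continuous_map (prod_topology \<tau> euclidean) euclidean (\<lambda>(x, u). \<pi> x u)"

definition invariant_under :: "('g \<Rightarrow> 'v \<Rightarrow> 'v) \<Rightarrow> 'g set \<Rightarrow> 'v set \<Rightarrow> bool" where
  "invariant_under \<pi> K W \<longleftrightarrow> (\<forall>x\<in>K. \<forall>w\<in>W. \<pi> x w \<in> W)"

definition closed_subrep ::
  "(complex \<Rightarrow> 'v \<Rightarrow> 'v) \<Rightarrow> 'g monoid \<Rightarrow> ('g \<Rightarrow> 'v::{t2_space,ab_group_add} \<Rightarrow> 'v) \<Rightarrow> 'v set \<Rightarrow> bool"
where
  "closed_subrep smul G \<pi> W \<longleftrightarrow>
     module.subspace smul W \<and> closed W \<and> invariant_under \<pi> (carrier G) W"

definition finite_length ::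
  "(complex \<Rightarrow> 'v \<Rightarrow> 'v) \<Rightarrow> 'g monoid \<Rightarrow> ('g \<Rightarrow> 'v::{t2_space,ab_group_add} \<Rightarrow> 'v) \<Rightarrow> bool"
where
  "finite_length smul G \<pi> \<longleftrightarrow>
     (\<exists>(n::nat) W. W 0 = {0} \<and> W n = UNIV \<and> (\<forall>i\<le>n. closed_subrep smul G \<pi> (W i)) \<and>
        (\<forall>i<n. W i \<subset> W (Suc i) \<and>
           \<not> (\<exists>W'. closed_subrep smul G \<pi> W' \<and> W i \<subset> W' \<and> W' \<subset> W (Suc i))))"

definition maximal_compact_subgroup :: "'g monoid \<Rightarrow> 'g topology \<Rightarrow> 'g set \<Rightarrow> bool" where
  "maximal_compact_subgroup G \<tau> K \<longleftrightarrow> subgroup K G \<and> compactin \<tau> K \<and>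
     (\<forall>K'. subgroup K' G \<longrightarrow> compactin \<tau> K' \<longrightarrow> K \<subseteq> K' \<longrightarrow> K' = K)"

definition finite_dim :: "(complex \<Rightarrow> 'v \<Rightarrow> 'v) \<Rightarrow> ('v::ab_group_add) set \<Rightarrow> bool" where
  "finite_dim smul W \<longleftrightarrow> (\<exists>B. finite B \<and> W \<subseteq> module.span smul B)"

text \<open>A subspace of \<open>V\<close> realizing a \<open>K\<close>-type.\<close>

definition K_type_in ::
  "(complex \<Rightarrow> 'v \<Rightarrow> 'v) \<Rightarrow> ('g \<Rightarrow> 'v::ab_group_add \<Rightarrow> 'v) \<Rightarrow> 'g set \<Rightarrow> 'v set \<Rightarrow> bool"
where
  "K_type_in smul \<pi> K W \<longleftrightarrow>
     module.subspace smul W \<and> finite_dim smul W \<and> W \<noteq> {0} \<and> invariant_under \<pi> K W \<and>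
     (\<forall>W'. module.subspace smul W' \<longrightarrow> W' \<subseteq> W \<longrightarrow> invariant_under \<pi> K W' \<longrightarrow> W' = {0} \<or> W' = W)"

definition K_isomorphic ::
  "(complex \<Rightarrow> 'v \<Rightarrow> 'v) \<Rightarrow> ('g \<Rightarrow> 'v::ab_group_add \<Rightarrow> 'v) \<Rightarrow> 'g set \<Rightarrow> 'v set \<Rightarrow> 'v set \<Rightarrow> bool"
where
  "K_isomorphic smul \<pi> K W W' \<longleftrightarrow>
     (\<exists>j. bij_betw j W W' \<and> (\<forall>u\<in>W. \<forall>v\<in>W. j (u + v) = j u + j v) \<and>
        (\<forall>c. \<forall>u\<in>W. j (smul c u) = smul c (j u)) \<and> (\<forall>x\<in>K. \<forall>u\<in>W. j (\<pi> x u) = \<pi> x (j u)))"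

definition isotypic_component ::
  "(complex \<Rightarrow> 'v \<Rightarrow> 'v) \<Rightarrow> ('g \<Rightarrow> 'v::ab_group_add \<Rightarrow> 'v) \<Rightarrow> 'g set \<Rightarrow> 'v set \<Rightarrow> 'v set"
where
  "isotypic_component smul \<pi> K W =
     module.span smul (\<Union>{W'. K_type_in smul \<pi> K W' \<and> K_isomorphic smul \<pi> K W W'})"

definition admissible ::
  "(complex \<Rightarrow> 'v \<Rightarrow> 'v) \<Rightarrow> 'g monoid \<Rightarrow> 'g topology \<Rightarrow> ('g \<Rightarrow> 'v::ab_group_add \<Rightarrow> 'v) \<Rightarrow> bool"
where
  "admissible smul G \<tau> \<pi> \<longleftrightarrow>
     (\<forall>K. maximal_compact_subgroup G \<tau> K \<longrightarrow>
        (\<forall>W. K_type_in smul \<pi> K W \<longrightarrow> finite_dim smul (isotypic_component smul \<pi> K W)))"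

definition Adj :: "'g monoid \<Rightarrow> mat2 set \<Rightarrow> (mat2 \<Rightarrow> 'g) \<Rightarrow> 'g \<Rightarrow> mat2 \<Rightarrow> mat2" where
  "Adj G \<gg> ex x A =
     (THE B. B \<in> \<gg> \<and> (\<forall>t::real. ex (t *\<^sub>R B) = x \<otimes>\<^bsub>G\<^esub> ex (t *\<^sub>R A) \<otimes>\<^bsub>G\<^esub> inv\<^bsub>G\<^esub> x))"

text \<open>
  The norm on \<open>G\<close> entering the moderate growth condition, computed in the adjoint representation;
  its kernel is finite for the groups of \<open>reductive_sl2_group\<close>.
\<close>

definition group_norm :: "'g monoid \<Rightarrow> mat2 set \<Rightarrow> (mat2 \<Rightarrow> 'g) \<Rightarrow> 'g \<Rightarrow> real" where
  "group_norm G \<gg> ex x =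
     (SUP A\<in>{A \<in> \<gg>. norm A \<le> 1}. max (norm (Adj G \<gg> ex x A)) (norm (Adj G \<gg> ex (inv\<^bsub>G\<^esub> x) A)))"

definition moderate_growth ::
  "(complex \<Rightarrow> 'v \<Rightarrow> 'v) \<Rightarrow> 'g monoid \<Rightarrow> mat2 set \<Rightarrow> (mat2 \<Rightarrow> 'g)
     \<Rightarrow> ('g \<Rightarrow> 'v::{t2_space,ab_group_add} \<Rightarrow> 'v) \<Rightarrow> bool"
where
  "moderate_growth smul G \<gg> ex \<pi> \<longleftrightarrow>
     (\<forall>q. seminorm smul q \<and> continuous_on UNIV q \<longrightarrow>
        (\<exists>q' (N::nat). seminorm smul q' \<and> continuous_on UNIV q' \<and>
           (\<forall>x\<in>carrier G. \<forall>u. q (\<pi> x u) \<le> group_norm G \<gg> ex x ^ N * q' u)))"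

text \<open>Membership in the category \<open>\<M>(G)\<close>.\<close>

definition in_category_M ::
  "(complex \<Rightarrow> 'v \<Rightarrow> 'v) \<Rightarrow> 'g monoid \<Rightarrow> 'g topology \<Rightarrow> ('g, 'e::euclidean_space) atlas \<Rightarrow> mat2 set
     \<Rightarrow> (mat2 \<Rightarrow> 'g) \<Rightarrow> ('g \<Rightarrow> 'v::{t2_space,ab_group_add} \<Rightarrow> 'v) \<Rightarrow> bool"
where
  "in_category_M smul G \<tau> \<A> \<gg> ex \<pi> \<longleftrightarrow>
     frechet_space smul TYPE('v) \<and> continuous_rep smul G \<tau> \<pi> \<and>
     (\<forall>u. smooth_fun (\<lambda>r. smul (of_real r)) \<A> (\<lambda>x. \<pi> x u)) \<and>
     admissible smul G \<tau> \<pi> \<and> finite_length smul G \<pi> \<and> moderate_growth smul G \<gg> ex \<pi>"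

definition symmetry_breaking_operator ::
  "(complex \<Rightarrow> 'v \<Rightarrow> 'v) \<Rightarrow> 'g set \<Rightarrow> ('g \<Rightarrow> 'v::{t2_space,ab_group_add} \<Rightarrow> 'v) \<Rightarrow> ('g \<Rightarrow> complex)
     \<Rightarrow> ('v \<Rightarrow> complex) \<Rightarrow> bool"
where
  "symmetry_breaking_operator smul G' \<pi> \<eta> T \<longleftrightarrow>
     Vector_Spaces.linear smul (*) T \<and> continuous_on UNIV T \<and>
     (\<forall>x\<in>G'. \<forall>u. T (\<pi> x u) = \<eta> x * T u)"


section \<open>The differential representation and infinitesimal characters\<close>

definition dpi ::
  "(complex \<Rightarrow> 'v \<Rightarrow> 'v) \<Rightarrow> (mat2 \<Rightarrow> 'g) \<Rightarrow> ('g \<Rightarrow> 'v::{t2_space,ab_group_add} \<Rightarrow> 'v) \<Rightarrow> mat2 \<Rightarrow> 'v \<Rightarrow> 'v"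
where
  "dpi smul ex \<pi> A u =
     Lim (at 0) (\<lambda>t::real. smul (of_real (inverse t)) (\<pi> (ex (t *\<^sub>R A)) u - u))"

text \<open>Its complex linear extension to \<open>sl(2,\<complex>)\<close>.\<close>

definition dpiC ::
  "(complex \<Rightarrow> 'v \<Rightarrow> 'v) \<Rightarrow> mat2 set \<Rightarrow> (mat2 \<Rightarrow> 'g) \<Rightarrow> ('g \<Rightarrow> 'v::{t2_space,ab_group_add} \<Rightarrow> 'v)
     \<Rightarrow> mat2 \<Rightarrow> 'v \<Rightarrow> 'v"
where
  "dpiC smul \<gg> ex \<pi> Z u =
     (let (A, B) = (THE (A, B). A \<in> \<gg> \<and> B \<in> \<gg> \<and> Z = A + cmat \<i> B)
      in dpi smul ex \<pi> A u + smul \<i> (dpi smul ex \<pi> B u))"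

text \<open>
  In the following \<open>act\<close> is an action of \<open>sl(2,\<complex>)\<close> on a complex vector space.  The center
  \<open>\<complex>[\<Omega>]\<close> of the enveloping algebra is represented by polynomials \<open>z\<close> in \<open>\<Omega>\<close>.
\<close>

definition casimir :: "(complex \<Rightarrow> 'w \<Rightarrow> 'w) \<Rightarrow> (mat2 \<Rightarrow> 'w \<Rightarrow> 'w) \<Rightarrow> 'w \<Rightarrow> 'w::ab_group_add" where
  "casimir smul act w = act Hmat (act Hmat w)
     + smul 2 (act Xmat (act Ymat w) + act Ymat (act Xmat w))"

definition center_act ::
  "(complex \<Rightarrow> 'w \<Rightarrow> 'w) \<Rightarrow> (mat2 \<Rightarrow> 'w \<Rightarrow> 'w) \<Rightarrow> complex poly \<Rightarrow> 'w \<Rightarrow> 'w::ab_group_add"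
where
  "center_act smul act z w = (\<Sum>i\<le>degree z. smul (coeff z i) ((casimir smul act ^^ i) w))"

definition hc_character :: "complex \<Rightarrow> complex poly \<Rightarrow> complex" where
  "hc_character lam z = poly z (lam\<^sup>2 - 1)"

definition has_inf_character ::
  "(complex \<Rightarrow> 'w \<Rightarrow> 'w) \<Rightarrow> (mat2 \<Rightarrow> 'w \<Rightarrow> 'w::ab_group_add) \<Rightarrow> complex \<Rightarrow> bool"
where
  "has_inf_character smul act lam \<longleftrightarrow>
     (\<forall>z w. center_act smul act z w = smul (hc_character lam z) w)"

definition primary_component ::
  "(complex \<Rightarrow> 'w \<Rightarrow> 'w) \<Rightarrow> (mat2 \<Rightarrow> 'w \<Rightarrow> 'w::ab_group_add) \<Rightarrow> complex \<Rightarrow> 'w set"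
where
  "primary_component smul act \<tau> =
     {w. \<forall>z. \<exists>n. ((\<lambda>v. center_act smul act z v - smul (hc_character \<tau> z) v) ^^ n) w = 0}"

definition center_acts_by_scalars ::
  "(complex \<Rightarrow> 'w \<Rightarrow> 'w) \<Rightarrow> (mat2 \<Rightarrow> 'w \<Rightarrow> 'w::ab_group_add) \<Rightarrow> 'w set \<Rightarrow> bool"
where
  "center_acts_by_scalars smul act W \<longleftrightarrow>
     (\<forall>z. \<exists>c. \<forall>w\<in>W. center_act smul act z w = smul c w)"

text \<open>The projection to the \<open>lam + \<delta>\<close> component along the \<open>lam - \<delta>\<close> component (for
  \<open>\<delta> = 1\<close> or \<open>\<delta> = -1\<close>); the decomposition itself is not built into any hypothesis.\<close>

definition pr_primary ::
  "(complex \<Rightarrow> 'w \<Rightarrow> 'w) \<Rightarrow> (mat2 \<Rightarrow> 'w \<Rightarrow> 'w::ab_group_add) \<Rightarrow> complex \<Rightarrow> complex \<Rightarrow> 'w \<Rightarrow> 'w"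
where
  "pr_primary smul act lam \<delta> w =
     (THE w'. w' \<in> primary_component smul act (lam + \<delta>) \<and>
              w - w' \<in> primary_component smul act (lam - \<delta>))"


section \<open>Tensoring with the natural representation\<close>

text \<open>
  \<open>V \<otimes> \<complex>\<^sup>2\<close> is modelled as \<open>V\<^sup>2\<close>, the pair \<open>(v\<^sub>1, v\<^sub>2)\<close> standing for
  \<open>v\<^sub>1 \<otimes> f\<^sub>+ + v\<^sub>2 \<otimes> f\<^sub>-\<close>, where \<open>f\<^sub>+\<close> and \<open>f\<^sub>-\<close> are the standard basis vectors.
  The vector \<open>f \<epsilon>\<close> below is meant for \<open>\<epsilon> = 1\<close> and \<open>\<epsilon> = -1\<close>.
\<close>

definition fbasis :: "int \<Rightarrow> complex^2" where
  "fbasis \<epsilon> = (if \<epsilon> = 1 then axis 1 1 else axis 2 1)"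

definition pr_line :: "int \<Rightarrow> complex^2 \<Rightarrow> complex^2" where
  "pr_line \<epsilon> a = (if \<epsilon> = 1 then a $ 1 else a $ 2) *s fbasis \<epsilon>"

definition tensor :: "(complex \<Rightarrow> 'v \<Rightarrow> 'v) \<Rightarrow> 'v \<Rightarrow> complex^2 \<Rightarrow> 'v^2" where
  "tensor smul u a = (\<chi> i. smul (a $ i) u)"

definition tensor_scale :: "(complex \<Rightarrow> 'v \<Rightarrow> 'v) \<Rightarrow> complex \<Rightarrow> 'v^2 \<Rightarrow> 'v^2" where
  "tensor_scale smul c w = (\<chi> i. smul c (w $ i))"

definition tensor_act ::
  "(complex \<Rightarrow> 'v \<Rightarrow> 'v) \<Rightarrow> (mat2 \<Rightarrow> 'v \<Rightarrow> 'v::ab_group_add) \<Rightarrow> mat2 \<Rightarrow> 'v^2 \<Rightarrow> 'v^2"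
where
  "tensor_act smul act Z w =
     (\<Sum>i\<in>UNIV. tensor smul (act Z (w $ i)) (axis i 1) + tensor smul (w $ i) (Z *v axis i 1))"

text \<open>\<open>T \<otimes> a\<close> for a functional \<open>T\<close> and a linear map \<open>a\<close> on \<open>\<complex>\<^sup>2\<close>, with values in \<open>\<complex> \<otimes> \<complex>\<^sup>2\<close>.\<close>

definition tensor_map ::
  "('v \<Rightarrow> complex) \<Rightarrow> (complex^2 \<Rightarrow> complex^2) \<Rightarrow> 'v^2 \<Rightarrow> complex^2"
where
  "tensor_map T a w = (\<Sum>i\<in>UNIV. tensor (*) (T (w $ i)) (a (axis i 1)))"

lemma sl2_triple:
  "commutator Hmat Xmat = cmat 2 Xmat" "commutator Hmat Ymat = cmat (-2) Ymat"
  "commutator Xmat Ymat = Hmat"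
  by (simp_all add: commutator_def cmat_def Hmat_def Xmat_def Ymat_def vec_eq_iff forall_2
      matrix_matrix_mult_def sum_2 vector_2)

lemma natural_representation:
  "Hmat *v fbasis 1 = fbasis 1" "Hmat *v fbasis (-1) = - fbasis (-1)"
  "Xmat *v fbasis 1 = 0" "Ymat *v fbasis (-1) = 0"
  "Xmat *v fbasis (-1) = fbasis 1" "Ymat *v fbasis 1 = fbasis (-1)"
  by (simp_all add: fbasis_def Hmat_def Xmat_def Ymat_def vec_eq_iff forall_2
      matrix_vector_mult_def sum_2 vector_2 axis_def)

lemma tensor_act_tensor:
  assumes "vector_space smul" "Vector_Spaces.linear smul smul (act Z)"
  shows "tensor_act smul act Z (tensor smul u a) =
           tensor smul (act Z u) a + tensor smul u (Z *v a)"
proof -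
  interpret vector_space smul by fact
  have s: "act Z (smul c v) = smul c (act Z v)" for c v
    by (rule module_hom.scale[OF assms(2)[unfolded linear_iff_module_hom]])
  show ?thesis
    by (simp add: tensor_act_def tensor_def vec_eq_iff forall_2 sum_2 matrix_vector_mult_def
        axis_def s scale_left_distrib algebra_simps)
qed

lemma tensor_map_tensor:
  assumes "Vector_Spaces.linear smul (*) T" "Vector_Spaces.linear (*s) (*s) a"
  shows "tensor_map T a (tensor smul u b) = tensor (*) (T u) (a b)"
proof -
  have b: "b = b $ 1 *s axis 1 1 + b $ 2 *s axis 2 1"
    by (simp add: vec_eq_iff forall_2 axis_def)
  have "a b = b $ 1 *s a (axis 1 1) + b $ 2 *s a (axis 2 1)"
    by (subst b) (simp add: module_hom.scale[OF assms(2)[unfolded linear_iff_module_hom]] 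
        module_hom.add[OF assms(2)[unfolded linear_iff_module_hom]])
  then show ?thesis
    by (simp add: tensor_map_def tensor_def vec_eq_iff sum_2
        module_hom.scale[OF assms(1)[unfolded linear_iff_module_hom]] algebra_simps)
qed

end

theory Submission
  imports Defs
begin

text \<open>
  On \<open>V \<otimes> \<complex>\<^sup>2 = V\<^sup>2\<close> the Casimir element acts as \<open>\<Omega> + 3\<close> plus a mixed term, and when \<open>\<Omega>\<close> is
  \<open>\<lambda>\<^sup>2 - 1\<close> on \<open>V\<close> this is \<open>\<lambda>\<^sup>2 + K\<close>, where \<open>K = 2 (N + 1)\<close> and \<open>N\<close> is the \<open>2 \<times> 2\<close> matrix of operators
  with rows \<open>(H, 2Y)\<close> and \<open>(2X, -H)\<close>.  The commutation relations give \<open>N\<^sup>2 = \<Omega> - 2N\<close>, that is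
  \<open>K\<^sup>2 = 4 \<lambda>\<^sup>2\<close> (lemma \<open>shifted_casimir_squared\<close>).  The Casimir element thus has at most the eigenvalues
  \<open>\<lambda>\<^sup>2 \<plusminus> 2\<lambda> = (\<lambda> \<plusminus> 1)\<^sup>2 - 1\<close> on \<open>V\<^sup>2\<close>; they are distinct since \<open>\<lambda> \<noteq> 0\<close>, and the projection to the
  component \<open>\<lambda> + \<delta>\<close> is \<open>(K + 2\<lambda>\<delta>) / (4\<lambda>\<delta>)\<close> (lemma \<open>pr_primary_eq\<close>).  Its diagonal entry at
  \<open>f\<^sub>\<epsilon>\<close> is \<open>(1 + \<epsilon>H + \<lambda>\<delta>) / (2\<lambda>\<delta>)\<close>.  A symmetry breaking operator turns \<open>H\<close> into
  \<open>\<nu>\<close> (lemma \<open>symmetry_breaking_H\<close>), and since \<open>\<delta>\<^sup>2 = 1\<close> the claimed factor results.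

  The analytic half of the proof shows that the differential of a smooth representation is a
  representation of the Lie algebra (lemmas \<open>dpi_lie_algebra\<close> and \<open>dpiC_commutator\<close>).  The bracket and
  the sum in the Lie algebra are tied to the group only through left-invariant vector fields acting
  on smooth real functions.  They are therefore tested on matrix coefficients
  \<open>x \<mapsto> l (\<pi> x u)\<close>, on which the vector field of \<open>A\<close> acts by replacing \<open>u\<close> with \<open>d\<pi>(A) u\<close> (lemma
  \<open>vector_field_matrix_coefficient\<close>).  Identities between the values of all real functionals \<open>l\<close>
  dominated by a defining seminorm become identities between vectors because these functionals
  separate the points of a Frechet space (lemma \<open>eq_if_functionals_eq\<close>), which is the Hahn-Banach theorem.
\<close>

section \<open>Linear functionals dominated by a sublinear functional\<close>

definition sublinear :: "(real \<Rightarrow> 'v \<Rightarrow> 'v) \<Rightarrow> ('v::ab_group_add \<Rightarrow> real) \<Rightarrow> bool" where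
  "sublinear sc q \<longleftrightarrow>
     (\<forall>x y. q (x + y) \<le> q x + q y) \<and> (\<forall>r x. 0 \<le> r \<longrightarrow> q (sc r x) = r * q x)"

lemma sublinearD:
  assumes "sublinear sc q"
  shows "q (x + y) \<le> q x + q y" "0 \<le> r \<Longrightarrow> q (sc r x) = r * q x"
  using assms by (auto simp: sublinear_def)

lemma sublinear_zero:
  assumes "vector_space sc" "sublinear sc q"
  shows "q 0 = 0"
proof -
  interpret vector_space sc by fact
  show ?thesis using sublinearD(2)[OF assms(2), of 0 0] by simp
qed

lemma sublinear_uminus_le:
  assumes "vector_space sc" "sublinear sc q"
  shows "- q (- x) \<le> q x"
  using sublinearD(1)[OF assms(2), of x "- x"] sublinear_zero[OF assms] by simp

text \<open>
  The largest sublinear functional below \<open>q\<close> whose value at \<open>- v\<close> is at most \<open>- q v\<close>.  It serves twice in the proof of the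
  Hahn-Banach theorem: a minimal sublinear functional cannot be lowered, hence is linear, and
  a linear functional below \<open>straighten sc q v\<close> attains the bound \<open>q\<close> at \<open>v\<close>.
\<close>

definition straighten :: "(real \<Rightarrow> 'v \<Rightarrow> 'v) \<Rightarrow> ('v::ab_group_add \<Rightarrow> real) \<Rightarrow> 'v \<Rightarrow> 'v \<Rightarrow> real" where
  "straighten sc q v x = (INF t\<in>{0..}. q (x + sc t v) - t * q v)"

lemma straighten:
  assumes vs: "vector_space sc" and q: "sublinear sc q"
  shows "sublinear sc (straighten sc q v)" "straighten sc q v x \<le> q x"
    "straighten sc q v (- v) \<le> - q v"
proof -
  interpret vector_space sc by fact
  let ?s = "straighten sc q v"
  have low: "- q (- x) \<le> q (x + sc t v) - t * q v" if "0 \<le> t" for x t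
    using sublinearD(1)[OF q, of "x + sc t v" "- x"] sublinearD(2)[OF q that, of v] by simp
  have s_le: "?s x \<le> q (x + sc t v) - t * q v" if "0 \<le> t" for x t
    unfolding straighten_def
    by (rule cINF_lower) (use low that in \<open>auto intro!: bdd_belowI2\<close>)
  have s_ge: "c \<le> ?s x" if "\<And>t. 0 \<le> t \<Longrightarrow> c \<le> q (x + sc t v) - t * q v" for c x
    unfolding straighten_def by (rule cINF_greatest) (use that in auto)
  show "?s x \<le> q x" for x using s_le[of 0 x] by simp
  show "?s (- v) \<le> - q v" using s_le[of 1 "- v"] sublinear_zero[OF vs q] by simp
  have zero: "?s 0 = 0"
  proof (rule antisym)
    show "?s 0 \<le> 0" using s_le[of 0 0] sublinear_zero[OF vs q] by simp
    show "0 \<le> ?s 0" by (rule s_ge) (use sublinearD(2)[OF q] in auto)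
  qed
  have hom_le: "?s (sc r x) \<le> r * ?s x" if r: "0 < r" for r x
  proof -
    have "?s (sc r x) / r \<le> ?s x"
    proof (rule s_ge)
      fix t :: real assume t: "0 \<le> t"
      have "?s (sc r x) \<le> q (sc r x + sc (r * t) v) - (r * t) * q v"
        using r t by (intro s_le) auto
      also have "sc r x + sc (r * t) v = sc r (x + sc t v)"
        by (simp add: scale_right_distrib)
      also have "q \<dots> = r * q (x + sc t v)" using r by (intro sublinearD(2)[OF q]) auto
      finally show "?s (sc r x) / r \<le> q (x + sc t v) - t * q v"
        using r by (simp add: field_simps)
    qed
    then show ?thesis using r by (simp add: field_simps)
  qed
  have hom: "?s (sc r x) = r * ?s x" if "0 \<le> r" for r x
  proof (cases "r = 0")
    case True then show ?thesis using zero by simp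
  next
    case False
    then have r: "0 < r" using that by simp
    have "?s x \<le> inverse r * ?s (sc r x)"
      using hom_le[of "inverse r" "sc r x"] r by simp
    then have "r * ?s x \<le> ?s (sc r x)" using r by (simp add: field_simps)
    then show ?thesis using hom_le[OF r, of x] by simp
  qed
  have sub: "?s (x + y) \<le> ?s x + ?s y" for x y
  proof -
    have "?s (x + y) - ?s y \<le> ?s x"
    proof (rule s_ge)
      fix t :: real assume t: "0 \<le> t"
      have "?s (x + y) - (q (x + sc t v) - t * q v) \<le> ?s y"
      proof (rule s_ge)
        fix r :: real assume r: "0 \<le> r"
        have "?s (x + y) \<le> q (x + y + sc (t + r) v) - (t + r) * q v"
          using r t by (intro s_le) auto
        also have "x + y + sc (t + r) v = (x + sc t v) + (y + sc r v)"
          by (simp add: algebra_simps)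
        also have "q \<dots> \<le> q (x + sc t v) + q (y + sc r v)" by (rule sublinearD(1)[OF q])
        finally show "?s (x + y) - (q (x + sc t v) - t * q v) \<le> q (y + sc r v) - r * q v"
          by (simp add: algebra_simps)
      qed
      then show "?s (x + y) - ?s y \<le> q (x + sc t v) - t * q v" by simp
    qed
    then show ?thesis by simp
  qed
  show "sublinear sc ?s" using hom sub by (simp add: sublinear_def)
qed

text \<open>
  Zorn's lemma applies because the pointwise infimum of a chain of sublinear functionals is again
  sublinear.  The infimum is finite, since every sublinear \<open>f \<le> p\<close> satisfies
  \<open>- p (- x) \<le> - f (- x) \<le> f x\<close>.
\<close>

lemma minimal_sublinear_exists:
  assumes vs: "vector_space sc" and p: "sublinear sc p"
  shows "\<exists>m. sublinear sc m \<and> m \<le> p \<and> (\<forall>q. sublinear sc q \<longrightarrow> q \<le> m \<longrightarrow> q = m)"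
proof -
  let ?A = "{q. sublinear sc q \<and> q \<le> p}"
  let ?P = "\<lambda>f g::'b \<Rightarrow> real. g \<le> f"
  have "\<exists>m\<in>?A. \<forall>a\<in>?A. ?P m a \<longrightarrow> a = m"
  proof (rule predicate_Zorn)
    show "partial_order_on ?A (relation_of ?P ?A)"
      by (auto simp: partial_order_on_def preorder_on_def refl_on_def trans_def antisym_def
          relation_of_def)
    show "\<exists>u\<in>?A. \<forall>a\<in>C. ?P a u" if C: "C \<in> Chains (relation_of ?P ?A)" for C
    proof (cases "C = {}")
      case True then show ?thesis using p by auto
    next
      case False
      have CA: "f \<in> ?A" if "f \<in> C" for f
        using C that by (auto simp: Chains_def relation_of_def)
      have lin: "f \<le> g \<or> g \<le> f" if "f \<in> C" "g \<in> C" for f g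
        using C that by (auto simp: Chains_def relation_of_def)
      define u where "u x = (INF f\<in>C. f x)" for x
      have low: "- p (- x) \<le> f x" if "f \<in> C" for f x
        using sublinear_uminus_le[OF vs, of f x] CA[OF that] by (simp add: le_fun_def) (meson le_minus_iff minus_le_iff order_trans)
      have u_le: "u x \<le> f x" if "f \<in> C" for f x
        unfolding u_def by (rule cINF_lower) (use low that in \<open>auto intro!: bdd_belowI2\<close>)
      have u_ge: "c \<le> u x" if "\<And>f. f \<in> C \<Longrightarrow> c \<le> f x" for c x
        unfolding u_def by (rule cINF_greatest) (use that False in auto)
      have sub: "u (x + y) \<le> u x + u y" for x y
      proof -
        have "u (x + y) - u y \<le> u x"
        proof (rule u_ge)
          fix f assume f: "f \<in> C"
          have "u (x + y) - f x \<le> u y"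
          proof (rule u_ge)
            fix g assume g: "g \<in> C"
            \<comment> \<open>In a chain the smaller of the two functionals bounds both summands at once.\<close>
            obtain h where h: "h \<in> C" "h \<le> f" "h \<le> g" using lin[OF f g] f g by blast
            have "u (x + y) \<le> h x + h y"
              using u_le[OF h(1), of "x + y"] CA[OF h(1)] sublinearD(1)[of sc h x y] by simp
            also have "\<dots> \<le> f x + g y" using h by (intro add_mono) (auto simp: le_fun_def)
            finally show "u (x + y) - f x \<le> g y" by simp
          qed
          then show "u (x + y) - u y \<le> f x" by simp
        qed
        then show ?thesis by simp
      qed
      have hom: "u (sc r x) = r * u x" if r: "0 \<le> r" for r x
      proof -
        have eq: "f (sc r x) = r * f x" if "f \<in> C" for f
          using CA[OF that] sublinearD(2)[OF _ r] by blast
        show ?thesis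
        proof (cases "r = 0")
          case True
          then have "f (sc r x) = 0" if "f \<in> C" for f using eq[OF that] by (simp only: mult_zero_left)
          then have "(\<lambda>f. f (sc r x)) ` C = {0}" using \<open>C \<noteq> {}\<close> by force
          then have "u (sc r x) = 0" by (simp add: u_def)
          then show ?thesis using True by simp
        next
          case False
          then have r: "0 < r" using r by simp
          show ?thesis
          proof (rule antisym)
            have "u (sc r x) / r \<le> u x"
              by (rule u_ge) (use u_le[of _ "sc r x"] eq r in \<open>auto simp: field_simps\<close>)
            then show "u (sc r x) \<le> r * u x" using r by (simp add: field_simps)
            show "r * u x \<le> u (sc r x)"
            proof (rule u_ge)
              fix f assume f: "f \<in> C"
              show "r * u x \<le> f (sc r x)" using u_le[OF f, of x] eq[OF f] r by simp
            qed
          qed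
        qed
      qed
      obtain f where f: "f \<in> C" using False by blast
      have "u \<le> p" using u_le[OF f] CA[OF f] by (auto simp: le_fun_def intro: order_trans)
      then have "u \<in> ?A" using sub hom by (simp add: sublinear_def)
      then show ?thesis using u_le by (auto simp: le_fun_def)
    qed
  qed
  then obtain m where m: "sublinear sc m" "m \<le> p"
    and min: "\<And>a. sublinear sc a \<Longrightarrow> a \<le> p \<Longrightarrow> a \<le> m \<Longrightarrow> a = m" by auto
  show ?thesis
  proof (intro exI[of _ m] conjI allI impI m)
    fix q assume "sublinear sc q" "q \<le> m"
    then show "q = m" using min[of q] m(2) by (meson order_trans)
  qed
qed

text \<open>
  Minimality forces \<open>straighten sc m v = m\<close>, and evaluating this at \<open>- v\<close> shows that \<open>m\<close> is odd.  An
  odd subadditive functional is additive.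
\<close>

lemma minimal_sublinear_linear:
  assumes vs: "vector_space sc" and m: "sublinear sc m"
    and min: "\<And>q. sublinear sc q \<Longrightarrow> q \<le> m \<Longrightarrow> q = m"
  shows "Vector_Spaces.linear sc (*) m"
proof -
  interpret vector_space sc by fact
  have odd: "m (- v) = - m v" for v
  proof -
    have "straighten sc m v = m"
      using straighten[OF vs m] by (intro min) (auto simp: le_fun_def)
    then have "m (- v) \<le> - m v" using straighten(3)[OF vs m, of v] by simp
    then show ?thesis using sublinear_uminus_le[OF vs m, of "v"] by simp
  qed
  have add: "m (x + y) = m x + m y" for x y
    using sublinearD(1)[OF m, of x y] sublinearD(1)[OF m, of "- x" "- y"] odd[of "x + y"]
      odd[of x] odd[of y] by simp
  have scl: "m (sc r x) = r * m x" for r x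
  proof (cases "0 \<le> r")
    case False
    then have "m (sc (- r) x) = - r * m x" by (intro sublinearD(2)[OF m]) simp
    then show ?thesis using odd[of "sc r x"] by simp
  qed (rule sublinearD(2)[OF m])
  show ?thesis
    using vs vector_space_over_itself.vector_space_axioms
    by (auto simp: Vector_Spaces.linear_def module_hom_def module_hom_axioms_def add scl
        vector_space_def module_def algebra_simps)
qed

text \<open>
  The Hahn-Banach theorem: extension from the line through \<open>v\<close> is replaced by minimising below
  \<open>straighten sc p v\<close>.
\<close>

lemma dominated_linear_functional:
  assumes vs: "vector_space sc" and p: "sublinear sc p"
  obtains l where "Vector_Spaces.linear sc (*) l" "\<And>x. l x \<le> p x" "p v \<le> l v"
proof -
  obtain m where m: "sublinear sc m" "m \<le> straighten sc p v"
    and min: "\<And>q. sublinear sc q \<Longrightarrow> q \<le> m \<Longrightarrow> q = m"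
    using minimal_sublinear_exists[OF vs straighten(1)[OF vs p]] by blast
  have le: "m x \<le> straighten sc p v x" for x using m(2) by (simp add: le_fun_def)
  show thesis
  proof
    show lin: "Vector_Spaces.linear sc (*) m" by (rule minimal_sublinear_linear[OF vs m(1) min])
    show "m x \<le> p x" for x using le[of x] straighten(2)[OF vs p, of v x] by simp
    have "m (- v) \<le> - p v" using le[of "- v"] straighten(3)[OF vs p, of v] by simp
    then show "p v \<le> m v"
      using module_hom.neg[OF lin[unfolded linear_iff_module_hom], of v] by simp
  qed
qed

section \<open>Calculus in a Frechet space\<close>

text \<open>
  Differentiability is expressed by a remainder that is small relative to \<open>\<bar>h\<bar>\<close>; in one variable
  dividing by \<open>h\<close> instead changes the quotient only by a sign.
\<close>

lemma difference_quotient_tendsto: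
  fixes \<gamma> :: "real \<Rightarrow> 'a::real_normed_vector"
  assumes "((\<lambda>h. inverse (norm h) *\<^sub>R (\<gamma> (t + h) - \<gamma> t - h *\<^sub>R v)) \<longlongrightarrow> 0) (at 0)"
  shows "((\<lambda>h. inverse h *\<^sub>R (\<gamma> (t + h) - \<gamma> t)) \<longlongrightarrow> v) (at 0)"
proof -
  have "norm (inverse (norm h) *\<^sub>R (\<gamma> (t + h) - \<gamma> t - h *\<^sub>R v)) =
      norm (inverse h *\<^sub>R (\<gamma> (t + h) - \<gamma> t) - v)" if "h \<noteq> 0" for h
  proof -
    have "inverse h *\<^sub>R (\<gamma> (t + h) - \<gamma> t) - v = inverse h *\<^sub>R (\<gamma> (t + h) - \<gamma> t - h *\<^sub>R v)"
      using that by (simp add: scaleR_right_diff_distrib)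
    then show ?thesis by simp
  qed
  then have "\<forall>\<^sub>F h in at 0. norm (inverse (norm h) *\<^sub>R (\<gamma> (t + h) - \<gamma> t - h *\<^sub>R v)) =
      norm (inverse h *\<^sub>R (\<gamma> (t + h) - \<gamma> t) - v)"
    by (simp add: eventually_at_filter)
  with tendsto_norm_zero[OF assms]
  have "((\<lambda>h. norm (inverse h *\<^sub>R (\<gamma> (t + h) - \<gamma> t) - v)) \<longlongrightarrow> 0) (at 0)"
    by (rule Lim_transform_eventually)
  then show ?thesis by (simp add: tendsto_norm_zero_iff LIM_zero_iff)
qed

locale frechet = vector_space smul
  for smul :: "complex \<Rightarrow> 'v::{t2_space,ab_group_add} \<Rightarrow> 'v" +
  fixes p :: "nat \<Rightarrow> 'v \<Rightarrow> real"
  assumes seminorm: "seminorm smul (p k)"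
    and open_iff: "open U \<longleftrightarrow> (\<forall>x\<in>U. \<exists>n. \<exists>e>0. {y. \<forall>k\<le>n. p k (y - x) < e} \<subseteq> U)"
begin

abbreviation rs :: "real \<Rightarrow> 'v \<Rightarrow> 'v" where "rs r \<equiv> smul (of_real r)"

sublocale real_scaling: vector_space rs
  by unfold_locales (simp_all add: scale_right_distrib scale_left_distrib)

lemma p_add: "p k (u + v) \<le> p k u + p k v"
  and p_scale: "p k (smul c u) = cmod c * p k u"
  using seminorm[of k] by (auto simp: seminorm_def)

lemma p_zero [simp]: "p k 0 = 0"
  using p_scale[of k 0 0] by simp

lemma p_uminus: "p k (- v) = p k v"
  using p_scale[of k "-1" v] by simp

lemma p_nonneg: "0 \<le> p k v"
  using p_add[of k v "- v"] by (simp add: p_uminus)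

lemma tendsto_seminorms:
  "(f \<longlongrightarrow> l) F \<longleftrightarrow> (\<forall>k. ((\<lambda>x. p k (f x - l)) \<longlongrightarrow> 0) F)"
proof
  assume f: "(f \<longlongrightarrow> l) F"
  show "\<forall>k. ((\<lambda>x. p k (f x - l)) \<longlongrightarrow> 0) F"
  proof
    fix k
    show "((\<lambda>x. p k (f x - l)) \<longlongrightarrow> 0) F"
    proof (rule tendstoI)
      fix e :: real assume e: "0 < e"
      let ?B = "{y. p k (y - l) < e}"
      have "open ?B"
        unfolding open_iff
      proof
        fix x assume x: "x \<in> ?B"
        have "{y. \<forall>j\<le>k. p j (y - x) < e - p k (x - l)} \<subseteq> ?B"
        proof
          fix y assume "y \<in> {y. \<forall>j\<le>k. p j (y - x) < e - p k (x - l)}"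
          then have "p k (y - x) < e - p k (x - l)" by blast
          then show "y \<in> ?B" using p_add[of k "y - x" "x - l"] by simp
        qed
        moreover have "0 < e - p k (x - l)" using x by simp
        ultimately show "\<exists>n. \<exists>d>0. {y. \<forall>j\<le>n. p j (y - x) < d} \<subseteq> ?B" by blast
      qed
      then have "\<forall>\<^sub>F x in F. f x \<in> ?B"
        by (rule topological_tendstoD[OF f]) (simp add: e)
      then show "\<forall>\<^sub>F x in F. dist (p k (f x - l)) 0 < e"
        by eventually_elim (simp add: p_nonneg)
    qed
  qed
next
  assume k: "\<forall>k. ((\<lambda>x. p k (f x - l)) \<longlongrightarrow> 0) F"
  show "(f \<longlongrightarrow> l) F"
  proof (rule topological_tendstoI)
    fix S assume "open S" "l \<in> S"
    then obtain n e where e: "0 < e" "{y. \<forall>k\<le>n. p k (y - l) < e} \<subseteq> S"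
      using open_iff by blast
    have "\<forall>\<^sub>F x in F. p j (f x - l) < e" for j
      using k e(1) by (intro order_tendstoD(2)[where y = 0]) auto
    then have "\<forall>\<^sub>F x in F. \<forall>j\<in>{..n}. p j (f x - l) < e"
      by (intro eventually_ball_finite) auto
    then show "\<forall>\<^sub>F x in F. f x \<in> S"
      by eventually_elim (use e(2) in auto)
  qed
qed

lemma tendsto_vadd:
  fixes f g :: "'a \<Rightarrow> 'v"
  assumes "(f \<longlongrightarrow> a) F" "(g \<longlongrightarrow> b) F"
  shows "((\<lambda>x. f x + g x) \<longlongrightarrow> a + b) F"
  unfolding tendsto_seminorms
proof
  fix k
  show "((\<lambda>x. p k (f x + g x - (a + b))) \<longlongrightarrow> 0) F"
  proof (rule tendsto_sandwich[where f = "\<lambda>_. 0"])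
    show "((\<lambda>x. p k (f x - a) + p k (g x - b)) \<longlongrightarrow> 0) F"
      using assms by (intro tendsto_add_zero) (simp_all add: tendsto_seminorms)
    show "\<forall>\<^sub>F x in F. p k (f x + g x - (a + b)) \<le> p k (f x - a) + p k (g x - b)"
      using p_add[of k "f _ - a" "g _ - b"] by (simp add: algebra_simps)
  qed (simp_all add: p_nonneg)
qed

lemma tendsto_vscale:
  assumes "(f \<longlongrightarrow> a) F"
  shows "((\<lambda>x. smul c (f x)) \<longlongrightarrow> smul c a) F"
  using assms tendsto_mult_right_zero[of _ F "cmod c"]
  by (simp add: tendsto_seminorms p_scale flip: scale_right_diff_distrib)

text \<open>
  If all seminorms vanish at \<open>v\<close>, the constant sequence \<open>v\<close> converges to \<open>0\<close> as well as to \<open>v\<close>.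
\<close>

lemma vector_eqI_seminorms:
  assumes "\<And>k. p k v = 0"
  shows "v = 0"
proof -
  have "((\<lambda>n::nat. v) \<longlongrightarrow> 0) sequentially"
    by (simp add: tendsto_seminorms assms)
  then show ?thesis by (simp add: tendsto_const_iff)
qed

lemma sublinear_seminorm: "sublinear rs (p k)"
  by (simp add: sublinear_def p_add p_scale)

definition bounded_functional :: "('v \<Rightarrow> real) \<Rightarrow> bool" where
  "bounded_functional l \<longleftrightarrow>
     Vector_Spaces.linear rs (*) l \<and> (\<exists>k. \<forall>v. \<bar>l v\<bar> \<le> p k v)"

lemma bounded_functionalD:
  assumes "bounded_functional l"
  shows "l (u + v) = l u + l v" "l (rs r u) = r * l u" "l (u - v) = l u - l v" "l 0 = 0"
proof -
  interpret module_hom rs "(*)" l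
    using assms by (simp add: bounded_functional_def linear_iff_module_hom)
  show "l (u + v) = l u + l v" "l (rs r u) = r * l u" "l (u - v) = l u - l v" "l 0 = 0"
    by (simp_all add: add scale diff)
qed

lemma tendsto_bounded_functional:
  assumes l: "bounded_functional l" and f: "(f \<longlongrightarrow> a) F"
  shows "((\<lambda>x. l (f x)) \<longlongrightarrow> l a) F"
proof -
  obtain k where k: "\<And>v. \<bar>l v\<bar> \<le> p k v" using l by (auto simp: bounded_functional_def)
  have "((\<lambda>x. l (f x) - l a) \<longlongrightarrow> 0) F"
  proof (rule tendsto_rabs_zero_cancel, rule tendsto_sandwich[where f = "\<lambda>_. 0"])
    show "((\<lambda>x. p k (f x - a)) \<longlongrightarrow> 0) F" using f by (simp add: tendsto_seminorms)
    show "\<forall>\<^sub>F x in F. \<bar>l (f x) - l a\<bar> \<le> p k (f x - a)"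
      using k[of "f _ - a"] by (simp add: bounded_functionalD(3)[OF l])
  qed simp_all
  then show ?thesis by (simp add: LIM_zero_iff)
qed

text \<open>
  A functional that is dominated by a seminorm and attains it at \<open>u - v\<close> distinguishes \<open>u\<close> from \<open>v\<close>.
\<close>

lemma eq_if_functionals_eq:
  assumes "\<And>l. bounded_functional l \<Longrightarrow> l u = l v"
  shows "u = v"
proof (rule ccontr)
  assume "u \<noteq> v"
  then obtain k where "p k (u - v) \<noteq> 0" using vector_eqI_seminorms[of "u - v"] by auto
  then have pos: "0 < p k (u - v)" using p_nonneg[of k "u - v"] by simp
  obtain l where l: "Vector_Spaces.linear rs (*) l" "\<And>x. l x \<le> p k x"
    "p k (u - v) \<le> l (u - v)"
    using dominated_linear_functional[OF real_scaling.vector_space_axioms sublinear_seminorm] by blast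
  have neg: "l (- x) = - l x" for x
    by (rule module_hom.neg[OF l(1)[unfolded linear_iff_module_hom]])
  have "\<bar>l x\<bar> \<le> p k x" for x
    using l(2)[of x] l(2)[of "- x"] by (simp add: neg p_uminus abs_le_iff)
  then have b: "bounded_functional l" using l(1) by (auto simp: bounded_functional_def)
  show False using assms[OF b] bounded_functionalD(3)[OF b, of u v] pos l(3) by simp
qed

lemma seminorm_linear_bound:
  fixes D :: "'a::euclidean_space \<Rightarrow> 'v"
  assumes D: "Vector_Spaces.linear (*\<^sub>R) rs D"
  shows "p k (D y) \<le> norm y * (\<Sum>b\<in>Basis. p k (D b))"
proof -
  interpret D: module_hom "(*\<^sub>R)" rs D using D by (simp add: linear_iff_module_hom)
  have p_sum: "p k (sum g B) \<le> (\<Sum>b\<in>B. p k (g b))" if "finite B" for g :: "'a \<Rightarrow> 'v" and B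
    using that by induction (auto intro: order_trans[OF p_add])
  have "D y = D (\<Sum>b\<in>Basis. (y \<bullet> b) *\<^sub>R b)" by (simp add: euclidean_representation)
  also have "\<dots> = (\<Sum>b\<in>Basis. rs (y \<bullet> b) (D b))" by (simp add: D.sum D.scale)
  finally have "p k (D y) \<le> (\<Sum>b\<in>Basis. \<bar>y \<bullet> b\<bar> * p k (D b))"
    using p_sum[OF finite_Basis, of "\<lambda>b. rs (y \<bullet> b) (D b)"] by (simp add: p_scale)
  also have "\<dots> \<le> (\<Sum>b\<in>Basis. norm y * p k (D b))"
    by (intro sum_mono mult_right_mono Basis_le_norm p_nonneg)
  finally show ?thesis by (simp add: sum_distrib_left)
qed

text \<open>
  The chain rule for a curve \<open>\<gamma>\<close> in a Euclidean space followed by a differentiable map into the Frechet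
  space.  The difference quotient splits into \<open>D\<close> at the quotient of \<open>\<gamma>\<close>, which converges as \<open>D\<close> is
  continuous, and the remainder of \<open>F\<close> times a factor that stays bounded.
\<close>

lemma difference_quotient_compose:
  fixes F :: "'a::euclidean_space \<Rightarrow> 'v" and \<gamma> :: "real \<Rightarrow> 'a"
  assumes D: "Vector_Spaces.linear (*\<^sub>R) rs D"
    and F: "((\<lambda>h. rs (inverse (norm h)) (F (\<gamma> t + h) - F (\<gamma> t) - D h)) \<longlongrightarrow> 0) (at 0)"
    and E: "Vector_Spaces.linear (*\<^sub>R) (*\<^sub>R) E"
    and \<gamma>: "((\<lambda>h. inverse (norm h) *\<^sub>R (\<gamma> (t + h) - \<gamma> t - E h)) \<longlongrightarrow> 0) (at 0)"
  shows "((\<lambda>h. rs (inverse h) (F (\<gamma> (t + h)) - F (\<gamma> t))) \<longlongrightarrow> D (E 1)) (at 0)"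
proof -
  interpret D: module_hom "(*\<^sub>R)" rs D using D by (simp add: linear_iff_module_hom)
  interpret E: module_hom "(*\<^sub>R)" "(*\<^sub>R)" E using E by (simp add: linear_iff_module_hom)
  define d where "d h = \<gamma> (t + h) - \<gamma> t" for h
  \<comment> \<open>Division by zero makes the normalised remainder vanish at 0, so it is continuous there, and it can be composed with increments that may be zero.\<close>
  define R where "R h = rs (inverse (norm h)) (F (\<gamma> t + h) - F (\<gamma> t) - D h)" for h
  have Eh: "h *\<^sub>R E 1 = E h" for h using E.scale[of h 1] by simp
  have q: "((\<lambda>h. inverse h *\<^sub>R d h) \<longlongrightarrow> E 1) (at 0)"
    unfolding d_def by (rule difference_quotient_tendsto) (simp only: Eh \<gamma>)
  have d0: "(d \<longlongrightarrow> 0) (at 0)"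
  proof -
    have "((\<lambda>h. h *\<^sub>R (inverse h *\<^sub>R d h)) \<longlongrightarrow> 0 *\<^sub>R E 1) (at 0)"
      by (intro tendsto_scaleR tendsto_ident_at q)
    then have "((\<lambda>h. h *\<^sub>R (inverse h *\<^sub>R d h)) \<longlongrightarrow> 0) (at 0)" by simp
    then show ?thesis
      by (rule Lim_transform_eventually) (simp add: eventually_at_filter)
  qed
  have R0: "R 0 = 0" by (simp add: R_def)
  have "(R \<longlongrightarrow> R 0) (at 0)" using F by (simp add: R0 R_def[abs_def])
  then have "isCont R 0" by (simp add: isCont_def)
  then have Rd: "((\<lambda>h. R (d h)) \<longlongrightarrow> 0) (at 0)"
    using isCont_tendsto_compose[OF _ d0, of R] R0 by simp
  have split: "rs (inverse h) (F (\<gamma> (t + h)) - F (\<gamma> t)) =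
      D (inverse h *\<^sub>R d h) + rs (inverse h * norm (d h)) (R (d h))" for h
  proof -
    have "F (\<gamma> (t + h)) - F (\<gamma> t) = D (d h) + rs (norm (d h)) (R (d h))"
      by (cases "d h = 0") (auto simp: R_def d_def)
    then show ?thesis by (simp add: D.scale scale_right_distrib)
  qed
  have "((\<lambda>h. D (inverse h *\<^sub>R d h)) \<longlongrightarrow> D (E 1)) (at 0)"
    unfolding tendsto_seminorms
  proof
    fix k
    show "((\<lambda>h. p k (D (inverse h *\<^sub>R d h) - D (E 1))) \<longlongrightarrow> 0) (at 0)"
    proof (rule tendsto_sandwich[where f = "\<lambda>_. 0"])
      show "((\<lambda>h. norm (inverse h *\<^sub>R d h - E 1) * (\<Sum>b\<in>Basis. p k (D b))) \<longlongrightarrow> 0) (at 0)"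
        using q by (intro tendsto_mult_left_zero) (simp add: tendsto_norm_zero_iff LIM_zero_iff)
      show "\<forall>\<^sub>F h in at 0. p k (D (inverse h *\<^sub>R d h) - D (E 1))
          \<le> norm (inverse h *\<^sub>R d h - E 1) * (\<Sum>b\<in>Basis. p k (D b))"
        using seminorm_linear_bound[OF D] by (simp flip: D.diff)
    qed (simp_all add: p_nonneg)
  qed
  moreover have "((\<lambda>h. rs (inverse h * norm (d h)) (R (d h))) \<longlongrightarrow> 0) (at 0)"
    unfolding tendsto_seminorms
  proof
    fix k
    have "((\<lambda>h. norm (inverse h *\<^sub>R d h) * p k (R (d h))) \<longlongrightarrow> norm (E 1) * 0) (at 0)"
      using Rd by (intro tendsto_mult tendsto_norm q) (simp add: tendsto_seminorms)
    then show "((\<lambda>h. p k (rs (inverse h * norm (d h)) (R (d h)) - 0)) \<longlongrightarrow> 0) (at 0)"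
      by (simp add: p_scale norm_mult norm_inverse)
  qed
  ultimately have "((\<lambda>h. rs (inverse h) (F (\<gamma> (t + h)) - F (\<gamma> t))) \<longlongrightarrow> D (E 1) + 0) (at 0)"
    unfolding split by (rule tendsto_vadd)
  then show ?thesis by simp
qed

lemma Ck_bounded_functional:
  fixes F :: "'a::euclidean_space \<Rightarrow> 'v"
  assumes l: "bounded_functional l" and "Ck rs k S F"
  shows "Ck (*\<^sub>R) k S (\<lambda>x. l (F x))"
  using assms(2)
proof (induction k arbitrary: F)
  case 0
  then show ?case
    by (auto simp: continuous_on_def intro: tendsto_bounded_functional[OF l])
next
  case (Suc k)
  then obtain D where
    lin: "\<And>x. x \<in> S \<Longrightarrow> Vector_Spaces.linear (*\<^sub>R) rs (D x)" and
    lim: "\<And>x. x \<in> S \<Longrightarrow>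
      ((\<lambda>h. rs (inverse (norm h)) (F (x + h) - F x - D x h)) \<longlongrightarrow> 0) (at 0)" and
    ck: "\<And>h. Ck rs k S (\<lambda>x. D x h)" by auto
  have l': "Vector_Spaces.linear rs (*\<^sub>R) l"
    using l by (simp add: bounded_functional_def real_scaleR_def[abs_def])
  show ?case
    unfolding Ck.simps
  proof (intro exI[of _ "\<lambda>x h. l (D x h)"] conjI ballI allI)
    fix x assume x: "x \<in> S"
    show "Vector_Spaces.linear (*\<^sub>R) (*\<^sub>R) (\<lambda>h. l (D x h))"
      using Vector_Spaces.linear_compose[OF lin[OF x] l'] by (simp add: o_def)
    show "((\<lambda>h. inverse (norm h) *\<^sub>R (l (F (x + h)) - l (F x) - l (D x h))) \<longlongrightarrow> 0) (at 0)"
      using tendsto_bounded_functional[OF l lim[OF x]]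
      by (simp add: bounded_functionalD[OF l] del: of_real_inverse)
  next
    fix h show "Ck (*\<^sub>R) k S (\<lambda>x. l (D x h))" by (rule Suc.IH[OF ck])
  qed
qed

end

lemma frechet_space_seminorms:
  fixes smul :: "complex \<Rightarrow> 'v::{t2_space,ab_group_add} \<Rightarrow> 'v"
  assumes "frechet_space smul TYPE('v)"
  obtains p where "frechet smul p"
  using assms unfolding frechet_space_def frechet_def frechet_axioms_def by blast

section \<open>The differential of a smooth representation\<close>

text \<open>
  The factor \<open>-1\<close> is kept as a real scalar so that both components are visibly built by the
  operations under which a real form is closed.
\<close>

lemma lie_bracket_real_form:
  "commutator (A + cmat \<i> B) (C + cmat \<i> D) =
     (commutator A C + (-1) *\<^sub>R commutator B D) + cmat \<i> (commutator A D + commutator B C)"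
  by (simp add: commutator_def cmat_def matrix_matrix_mult_def vec_eq_iff forall_2 sum_2 
      algebra_simps)

locale smooth_rep = frechet smul p
  for smul :: "complex \<Rightarrow> 'v::{t2_space,ab_group_add} \<Rightarrow> 'v" and p +
  fixes G :: "'g monoid" and \<tau> :: "'g topology" and \<A> :: "('g, 'e::euclidean_space) atlas"
    and \<gg> :: "mat2 set" and ex :: "mat2 \<Rightarrow> 'g" and \<pi> :: "'g \<Rightarrow> 'v \<Rightarrow> 'v"
  assumes lie_group: "lie_group G \<tau> \<A>"
    and lie_algebra: "lie_algebra_of G \<tau> \<A> \<gg> ex"
    and real_form: "real_form_sl2 \<gg>"
    and rep: "continuous_rep smul G \<tau> \<pi>"
    and smooth: "\<And>u. smooth_fun rs \<A> (\<lambda>x. \<pi> x u)"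
begin

abbreviation d\<pi> :: "mat2 \<Rightarrow> 'v \<Rightarrow> 'v" where "d\<pi> \<equiv> dpi smul ex \<pi>"

abbreviation d\<pi>C :: "mat2 \<Rightarrow> 'v \<Rightarrow> 'v" where "d\<pi>C \<equiv> dpiC smul \<gg> ex \<pi>"

lemma group: "group G" and topspace: "topspace \<tau> = carrier G" and atlas: "smooth_atlas \<tau> \<A>"
  using lie_group by (auto simp: lie_group_def)

lemma lie_zero: "0 \<in> \<gg>"
  and lie_add: "A \<in> \<gg> \<Longrightarrow> B \<in> \<gg> \<Longrightarrow> A + B \<in> \<gg>"
  and lie_scale: "A \<in> \<gg> \<Longrightarrow> c *\<^sub>R A \<in> \<gg>"
  and commutator_closed: "A \<in> \<gg> \<Longrightarrow> B \<in> \<gg> \<Longrightarrow> commutator A B \<in> \<gg>"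
  using lie_algebra unfolding lie_algebra_of_def real_vector.subspace_def by metis+

lemma curve_smooth: "A \<in> \<gg> \<Longrightarrow>
    smooth_map euclidean {(UNIV, \<lambda>t. t)} \<tau> \<A> (\<lambda>t::real. ex (t *\<^sub>R A))"
  and ex_add: "A \<in> \<gg> \<Longrightarrow> ex ((s + t) *\<^sub>R A) = ex (s *\<^sub>R A) \<otimes>\<^bsub>G\<^esub> ex (t *\<^sub>R A)"
  using lie_algebra by (simp_all only: lie_algebra_of_def)

lemma
  assumes A: "A \<in> \<gg>" and B: "B \<in> \<gg>" and f: "smooth_real_fun \<A> f" and x: "x \<in> carrier G"
  shows vector_field_add:
      "vector_field G ex (A + B) f x = vector_field G ex A f x + vector_field G ex B f x" (is ?add)
    and vector_field_scale:
      "vector_field G ex (c *\<^sub>R A) f x = c * vector_field G ex A f x" (is ?scale)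
    and vector_field_commutator: "vector_field G ex (commutator A B) f x =
        vector_field G ex A (vector_field G ex B f) x - vector_field G ex B (vector_field G ex A f) x"
      (is ?bracket)
proof -
  have "\<forall>A\<in>\<gg>. \<forall>B\<in>\<gg>. \<forall>c. \<forall>f. smooth_real_fun \<A> f \<longrightarrow> (\<forall>x\<in>carrier G.
      vector_field G ex (A + B) f x = vector_field G ex A f x + vector_field G ex B f x \<and>
      vector_field G ex (c *\<^sub>R A) f x = c * vector_field G ex A f x \<and>
      vector_field G ex (commutator A B) f x =
        vector_field G ex A (vector_field G ex B f) x - vector_field G ex B (vector_field G ex A f) x)"
    using lie_algebra unfolding lie_algebra_of_def by (elim conjE)
  from this[rule_format, OF A B f x] show ?add ?scale ?bracket by blast+
qed

lemma ex_carrier: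
  assumes "A \<in> \<gg>"
  shows "ex A \<in> carrier G"
proof -
  have "continuous_map euclidean \<tau> (\<lambda>t::real. ex (t *\<^sub>R A))"
    using curve_smooth[OF assms] by (simp add: smooth_map_def)
  then have "ex ((1::real) *\<^sub>R A) \<in> topspace \<tau>" using continuous_map_image_subset_topspace by fastforce
  then show ?thesis by (simp add: topspace)
qed

lemma ex_scaled_carrier: "A \<in> \<gg> \<Longrightarrow> ex (t *\<^sub>R A) \<in> carrier G"
  by (intro ex_carrier lie_scale)

lemma ex_zero: "ex 0 = \<one>\<^bsub>G\<^esub>"
proof -
  interpret group G by (rule group)
  have "ex 0 \<otimes>\<^bsub>G\<^esub> ex 0 = ex 0" using ex_add[OF lie_zero, of 0 0] by simp
  then show ?thesis using ex_carrier[OF lie_zero] r_cancel_one by blast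
qed

lemma rep_linear: "x \<in> carrier G \<Longrightarrow> Vector_Spaces.linear smul smul (\<pi> x)"
  and rep_one: "\<pi> \<one>\<^bsub>G\<^esub> u = u"
  and rep_mult: "x \<in> carrier G \<Longrightarrow> y \<in> carrier G \<Longrightarrow> \<pi> (x \<otimes>\<^bsub>G\<^esub> y) u = \<pi> x (\<pi> y u)"
  using rep by (auto simp: continuous_rep_def)

lemma rep_module_hom: "x \<in> carrier G \<Longrightarrow> module_hom smul smul (\<pi> x)"
  using rep_linear by (simp add: linear_iff_module_hom)

lemma rep_continuous:
  assumes x: "x \<in> carrier G" and f: "(f \<longlongrightarrow> a) F"
  shows "((\<lambda>y. \<pi> x (f y)) \<longlongrightarrow> \<pi> x a) F"
proof -
  have "continuous_map euclidean (prod_topology \<tau> euclidean) (\<lambda>u::'v. (x, u))"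
    using x by (simp add: continuous_map_pairedI topspace)
  moreover have "continuous_map (prod_topology \<tau> euclidean) euclidean (\<lambda>(x, u). \<pi> x u)"
    using rep by (simp add: continuous_rep_def)
  ultimately have "continuous_map euclidean euclidean ((\<lambda>(x, u). \<pi> x u) \<circ> (\<lambda>u. (x, u)))"
    by (rule continuous_map_compose)
  then have "continuous_on UNIV (\<pi> x)" by (simp add: o_def)
  then show ?thesis
    using continuous_on_tendsto_compose[OF _ f, of UNIV "\<pi> x"] by simp
qed

text \<open>
  In a chart around the identity the orbit curve is the composition of a smooth curve with
  the smooth orbit map, so the limit that defines \<open>d\<pi> A u\<close> exists by the chain rule.
\<close>

lemma orbit_derivative:
  assumes A: "A \<in> \<gg>"
  shows "((\<lambda>t. rs (inverse t) (\<pi> (ex (t *\<^sub>R A)) u - u)) \<longlongrightarrow> d\<pi> A u) (at 0)"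
proof -
  interpret group G by (rule group)
  have "\<one>\<^bsub>G\<^esub> \<in> (\<Union>(U, \<phi>)\<in>\<A>. U)" using atlas topspace by (auto simp: smooth_atlas_def)
  then obtain U \<phi> where chart: "(U, \<phi>) \<in> \<A>" and one: "\<one>\<^bsub>G\<^esub> \<in> U" by auto
  have U: "openin \<tau> U" and hom: "homeomorphic_map (subtopology \<tau> U) (top_of_set (\<phi> ` U)) \<phi>"
    using atlas chart by (auto simp: smooth_atlas_def)
  have "inj_on \<phi> (topspace (subtopology \<tau> U))" by (rule homeomorphic_imp_injective_map[OF hom])
  then have inj: "inj_on \<phi> U" using openin_subset[OF U] by (simp add: Int_absorb1)
  let ?c = "\<lambda>t::real. ex (t *\<^sub>R A)"
  define \<gamma> where "\<gamma> t = \<phi> (?c t)" for t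
  define F where "F = (\<lambda>x. \<pi> x u) \<circ> inv_into U \<phi>"
  have c0: "?c 0 \<in> U" using one by (simp add: ex_zero)
  have "smooth_on rs (\<phi> ` U) F"
    using smooth[of u] chart by (auto simp: smooth_fun_def F_def)
  then have "Ck rs (Suc 0) (\<phi> ` U) F" by (simp only: smooth_on_def)
  moreover have "\<gamma> 0 \<in> \<phi> ` U" using c0 by (simp add: \<gamma>_def)
  ultimately obtain D where D: "Vector_Spaces.linear (*\<^sub>R) rs D"
    "((\<lambda>h. rs (inverse (norm h)) (F (\<gamma> 0 + h) - F (\<gamma> 0) - D h)) \<longlongrightarrow> 0) (at 0)"
    by auto
  have inv: "inv_into UNIV (\<lambda>t::real. t) = (\<lambda>t. t)" using inv_id by (simp add: id_def)
  have sm: "continuous_map euclidean \<tau> ?c" "smooth_on (*\<^sub>R) (?c -` U) \<gamma>"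
    using curve_smooth[OF A] chart by (auto simp: smooth_map_def inv o_def \<gamma>_def[abs_def])
  have "Ck (*\<^sub>R) (Suc 0) (?c -` U) \<gamma>" using sm(2) by (simp only: smooth_on_def)
  moreover have "0 \<in> ?c -` U" using c0 by simp
  ultimately obtain E where E: "Vector_Spaces.linear (*\<^sub>R) (*\<^sub>R) E"
    "((\<lambda>h. inverse (norm h) *\<^sub>R (\<gamma> (0 + h) - \<gamma> 0 - E h)) \<longlongrightarrow> 0) (at 0)"
    unfolding Ck.simps by blast
  have lim: "((\<lambda>h. rs (inverse h) (F (\<gamma> (0 + h)) - F (\<gamma> 0))) \<longlongrightarrow> D (E 1)) (at 0)"
    by (rule difference_quotient_compose[OF D E])
  have F\<gamma>: "F (\<gamma> t) = \<pi> (?c t) u" if "?c t \<in> U" for t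
    using that inj by (simp add: F_def \<gamma>_def)
  have "open (?c -` U)"
    using openin_continuous_map_preimage[OF sm(1) U] by (simp add: vimage_def)
  then have "\<forall>\<^sub>F t in at 0. ?c t \<in> U"
    using c0 by (auto simp: eventually_at_topological)
  then have "\<forall>\<^sub>F t in at 0. rs (inverse t) (F (\<gamma> (0 + t)) - F (\<gamma> 0)) =
      rs (inverse t) (\<pi> (?c t) u - u)"
    by eventually_elim (use F\<gamma>[OF c0] F\<gamma> in \<open>simp add: ex_zero rep_one\<close>)
  then have "((\<lambda>t. rs (inverse t) (\<pi> (?c t) u - u)) \<longlongrightarrow> D (E 1)) (at 0)"
    by (rule Lim_transform_eventually[OF lim])
  moreover from this have "d\<pi> A u = D (E 1)"
    unfolding dpi_def by (intro tendsto_Lim) auto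
  ultimately show ?thesis by simp
qed

lemma dpi_add_vector:
  assumes A: "A \<in> \<gg>"
  shows "d\<pi> A (u + v) = d\<pi> A u + d\<pi> A v"
proof (rule tendsto_unique[OF _ orbit_derivative[OF A]])
  interpret \<pi>: module_hom smul smul "\<pi> (ex (t *\<^sub>R A))" for t
    by (rule rep_module_hom[OF ex_scaled_carrier[OF A]])
  show "((\<lambda>t. rs (inverse t) (\<pi> (ex (t *\<^sub>R A)) (u + v) - (u + v))) \<longlongrightarrow> d\<pi> A u + d\<pi> A v) (at 0)"
    using tendsto_vadd[OF orbit_derivative[OF A, of u] orbit_derivative[OF A, of v]]
    by (simp add: \<pi>.add algebra_simps)
qed simp

lemma dpi_scale_vector:
  assumes A: "A \<in> \<gg>"
  shows "d\<pi> A (smul c u) = smul c (d\<pi> A u)"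
proof (rule tendsto_unique[OF _ orbit_derivative[OF A]])
  interpret \<pi>: module_hom smul smul "\<pi> (ex (t *\<^sub>R A))" for t
    by (rule rep_module_hom[OF ex_scaled_carrier[OF A]])
  show "((\<lambda>t. rs (inverse t) (\<pi> (ex (t *\<^sub>R A)) (smul c u) - smul c u)) \<longlongrightarrow> smul c (d\<pi> A u)) (at 0)"
    using tendsto_vscale[OF orbit_derivative[OF A, of u], of c]
    by (simp add: \<pi>.scale algebra_simps)
qed simp

lemma matrix_coefficient_smooth:
  assumes "bounded_functional l"
  shows "smooth_real_fun \<A> (\<lambda>x. l (\<pi> x u))"
  unfolding smooth_fun_def smooth_on_def
proof (intro ballI allI, clarify)
  fix U \<phi> k assume "(U, \<phi>) \<in> \<A>"
  then have "Ck rs k (\<phi> ` U) ((\<lambda>x. \<pi> x u) \<circ> inv_into U \<phi>)"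
    using smooth[of u] unfolding smooth_fun_def smooth_on_def by (auto simp del: Ck.simps)
  from Ck_bounded_functional[OF assms this]
  show "Ck (*\<^sub>R) k (\<phi> ` U) ((\<lambda>x. l (\<pi> x u)) \<circ> inv_into U \<phi>)"
    by (simp add: o_def)
qed

text \<open>
  The left-invariant vector field of \<open>A\<close> differentiates \<open>l (\<pi> x (\<pi> (ex (tA)) u))\<close> at \<open>t = 0\<close>.  The
  function \<open>f\<close> is allowed to differ from the matrix coefficient outside the group, so that the lemma
  can be applied once more to the function that it produces.
\<close>

lemma vector_field_matrix_coefficient:
  assumes l: "bounded_functional l" and A: "A \<in> \<gg>" and x: "x \<in> carrier G"
    and f: "\<And>y. y \<in> carrier G \<Longrightarrow> f y = l (\<pi> y u)"
  shows "vector_field G ex A f x = l (\<pi> x (d\<pi> A u))"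
proof -
  interpret group G by (rule group)
  interpret \<pi>: module_hom smul smul "\<pi> x" by (rule rep_module_hom[OF x])
  let ?f = "\<lambda>t. f (x \<otimes>\<^bsub>G\<^esub> ex (t *\<^sub>R A))"
  have ft: "?f t = l (\<pi> x (\<pi> (ex (t *\<^sub>R A)) u))" for t
    using ex_scaled_carrier[OF A] x by (simp add: f rep_mult)
  have "((\<lambda>t. l (\<pi> x (rs (inverse t) (\<pi> (ex (t *\<^sub>R A)) u - u)))) \<longlongrightarrow> l (\<pi> x (d\<pi> A u))) (at 0)"
    by (intro tendsto_bounded_functional[OF l] rep_continuous[OF x] orbit_derivative[OF A])
  moreover have "l (\<pi> x (rs (inverse t) (\<pi> (ex (t *\<^sub>R A)) u - u))) = (?f (0 + t) - ?f 0) / t" for t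
    unfolding ft \<pi>.scale bounded_functionalD(2)[OF l]
    by (simp add: ex_zero rep_one \<pi>.diff bounded_functionalD(3)[OF l] divide_inverse)
  ultimately have "(?f has_field_derivative l (\<pi> x (d\<pi> A u))) (at 0)"
    by (simp add: DERIV_def)
  then show ?thesis unfolding vector_field_def by (rule DERIV_imp_deriv)
qed


text \<open>
  Each identity is the corresponding one for vector fields, evaluated on matrix coefficients at the
  identity of the group.
\<close>

lemma dpi_lie_algebra:
  assumes A: "A \<in> \<gg>" and B: "B \<in> \<gg>"
  shows "d\<pi> (A + B) u = d\<pi> A u + d\<pi> B u" "d\<pi> (c *\<^sub>R A) u = rs c (d\<pi> A u)"
    "d\<pi> (commutator A B) u = d\<pi> A (d\<pi> B u) - d\<pi> B (d\<pi> A u)"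
proof -
  interpret group G by (rule group)
  have mem: "A + B \<in> \<gg>" "c *\<^sub>R A \<in> \<gg>" "commutator A B \<in> \<gg>"
    using A B by (auto intro: lie_add lie_scale commutator_closed)
  have vf: "vector_field G ex C (\<lambda>x. l (\<pi> x w)) x = l (\<pi> x (d\<pi> C w))"
    if "bounded_functional l" "C \<in> \<gg>" "x \<in> carrier G" for l C x w
    by (rule vector_field_matrix_coefficient[OF that]) simp
  have vf2: "vector_field G ex C (vector_field G ex C' (\<lambda>x. l (\<pi> x u))) \<one>\<^bsub>G\<^esub> = l (d\<pi> C (d\<pi> C' u))"
    if "bounded_functional l" "C \<in> \<gg>" "C' \<in> \<gg>" for l C C'
    using vector_field_matrix_coefficient[OF that(1,2) one_closed vf[OF that(1,3)], of u]
    by (simp add: rep_one)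
  have sm: "smooth_real_fun \<A> (\<lambda>x. l (\<pi> x u))" if "bounded_functional l" for l
    by (rule matrix_coefficient_smooth[OF that])
  note vf1 = vf[OF _ _ one_closed, unfolded rep_one]
  show "d\<pi> (A + B) u = d\<pi> A u + d\<pi> B u"
  proof (rule eq_if_functionals_eq)
    fix l assume l: "bounded_functional l"
    show "l (d\<pi> (A + B) u) = l (d\<pi> A u + d\<pi> B u)"
      using vector_field_add[OF A B sm[OF l] one_closed]
      unfolding vf1[OF l A] vf1[OF l B] vf1[OF l mem(1)] bounded_functionalD(1)[OF l] .
  qed
  show "d\<pi> (c *\<^sub>R A) u = rs c (d\<pi> A u)"
  proof (rule eq_if_functionals_eq)
    fix l assume l: "bounded_functional l"
    show "l (d\<pi> (c *\<^sub>R A) u) = l (rs c (d\<pi> A u))"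
      using vector_field_scale[OF A A sm[OF l] one_closed, where c = c]
      unfolding vf1[OF l A] vf1[OF l mem(2)] bounded_functionalD(2)[OF l] .
  qed
  show "d\<pi> (commutator A B) u = d\<pi> A (d\<pi> B u) - d\<pi> B (d\<pi> A u)"
  proof (rule eq_if_functionals_eq)
    fix l assume l: "bounded_functional l"
    show "l (d\<pi> (commutator A B) u) = l (d\<pi> A (d\<pi> B u) - d\<pi> B (d\<pi> A u))"
      using vector_field_commutator[OF A B sm[OF l] one_closed]
      unfolding vf2[OF l A B] vf2[OF l B A] vf1[OF l mem(3)] bounded_functionalD(3)[OF l] .
  qed
qed

lemma complex_decomposition:
  assumes "Z \<in> sl2"
  obtains A B where "A \<in> \<gg>" "B \<in> \<gg>" "Z = A + cmat \<i> B"
proof -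
  have "\<exists>!(A, B). A \<in> \<gg> \<and> B \<in> \<gg> \<and> Z = A + cmat \<i> B"
    using real_form assms unfolding real_form_sl2_def by (elim conjE) (rule bspec)
  from ex1_implies_ex[OF this] show ?thesis using that by (auto simp only: split_paired_Ex prod.case)
qed

lemma dpiC_decomposed:
  assumes A: "A \<in> \<gg>" and B: "B \<in> \<gg>"
  shows "d\<pi>C (A + cmat \<i> B) u = d\<pi> A u + smul \<i> (d\<pi> B u)"
proof -
  have "A \<in> sl2" "B \<in> sl2" using A B real_form by (auto simp: real_form_sl2_def)
  then have "A $ 1 $ 1 = - A $ 2 $ 2" "B $ 1 $ 1 = - B $ 2 $ 2"
    by (simp_all add: sl2_def trace_def sum_2 eq_neg_iff_add_eq_0)
  then have "A + cmat \<i> B \<in> sl2"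
    by (simp add: sl2_def trace_def sum_2 cmat_def)
  then have "\<exists>!(A', B'). A' \<in> \<gg> \<and> B' \<in> \<gg> \<and> A + cmat \<i> B = A' + cmat \<i> B'"
    using real_form unfolding real_form_sl2_def by (elim conjE) (rule bspec)
  then have "(THE (A', B'). A' \<in> \<gg> \<and> B' \<in> \<gg> \<and> A + cmat \<i> B = A' + cmat \<i> B') = (A, B)"
    by (rule the1_equality) (use A B in simp)
  then show ?thesis by (simp add: dpiC_def)
qed

lemma dpiC_linear:
  assumes "Z \<in> sl2"
  shows "Vector_Spaces.linear smul smul (d\<pi>C Z)"
proof -
  obtain A B where A: "A \<in> \<gg>" and B: "B \<in> \<gg>" and Z: "Z = A + cmat \<i> B"
    by (rule complex_decomposition[OF assms])
  have "d\<pi>C Z (u + v) = d\<pi>C Z u + d\<pi>C Z v" for u v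
    unfolding Z dpiC_decomposed[OF A B]
    by (simp add: dpi_add_vector A B scale_right_distrib add_ac)
  moreover have "d\<pi>C Z (smul c u) = smul c (d\<pi>C Z u)" for c u
    unfolding Z dpiC_decomposed[OF A B]
    by (simp add: dpi_scale_vector A B scale_right_distrib mult.commute)
  ultimately show ?thesis
    using vector_space_axioms by (simp add: Vector_Spaces.linear_iff)
qed

lemma dpiC_scaleR:
  assumes "Z \<in> sl2"
  shows "d\<pi>C (cmat (of_real r) Z) u = rs r (d\<pi>C Z u)"
proof -
  obtain A B where A: "A \<in> \<gg>" and B: "B \<in> \<gg>" and Z: "Z = A + cmat \<i> B"
    by (rule complex_decomposition[OF assms])
  have eq: "cmat (of_real r) Z = r *\<^sub>R A + cmat \<i> (r *\<^sub>R B)"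
    unfolding Z cmat_def by (simp add: vec_eq_iff algebra_simps scaleR_conv_of_real[where 'a = complex])
  have "r *\<^sub>R A \<in> \<gg>" "r *\<^sub>R B \<in> \<gg>" using A B by (auto intro: lie_scale)
  then show ?thesis
    unfolding eq dpiC_decomposed[OF \<open>r *\<^sub>R A \<in> \<gg>\<close> \<open>r *\<^sub>R B \<in> \<gg>\<close>]
    by (simp add: dpiC_decomposed Z A B dpi_lie_algebra(2)[OF A A] dpi_lie_algebra(2)[OF B B]
        scale_right_distrib mult.commute)
qed

lemma dpiC_commutator:
  assumes "Z \<in> sl2" "W \<in> sl2"
  shows "d\<pi>C (commutator Z W) u = d\<pi>C Z (d\<pi>C W u) - d\<pi>C W (d\<pi>C Z u)"
proof -
  obtain A B where A: "A \<in> \<gg>" and B: "B \<in> \<gg>" and Z: "Z = A + cmat \<i> B"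
    by (rule complex_decomposition[OF assms(1)])
  obtain C D where C: "C \<in> \<gg>" and D: "D \<in> \<gg>" and W: "W = C + cmat \<i> D"
    by (rule complex_decomposition[OF assms(2)])
  note br = commutator_closed[OF A C] commutator_closed[OF B D] commutator_closed[OF A D]
    commutator_closed[OF B C]
  have neg: "(-1) *\<^sub>R commutator B D \<in> \<gg>" by (intro lie_scale br)
  have m: "commutator A C + (-1) *\<^sub>R commutator B D \<in> \<gg>" "commutator A D + commutator B C \<in> \<gg>"
    by (intro lie_add neg br)+
  have "d\<pi>C (commutator Z W) u =
      (d\<pi> (commutator A C) u - d\<pi> (commutator B D) u) +
      smul \<i> (d\<pi> (commutator A D) u + d\<pi> (commutator B C) u)"
    unfolding Z W lie_bracket_real_form dpiC_decomposed[OF m]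
      dpi_lie_algebra(1)[OF br(1) neg] dpi_lie_algebra(1)[OF br(3,4)] dpi_lie_algebra(2)[OF br(2,2)]
    by simp
  also have "\<dots> = d\<pi>C Z (d\<pi>C W u) - d\<pi>C W (d\<pi>C Z u)"
    unfolding Z W dpiC_decomposed[OF A B] dpiC_decomposed[OF C D]
      dpi_lie_algebra(3)[OF A C] dpi_lie_algebra(3)[OF B D] dpi_lie_algebra(3)[OF A D]
      dpi_lie_algebra(3)[OF B C]
    by (simp add: dpi_add_vector dpi_scale_vector A B C D algebra_simps)
  finally show ?thesis .
qed

text \<open>
  The matrix \<open>H\<close> itself need not lie in the real Lie algebra: it is \<open>A + iB\<close>
  with \<open>A = aH\<close> and \<open>B = bH\<close> in the Lie algebra of the subgroup and \<open>a + ib = 1\<close>.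
  Equivariance is differentiated along \<open>A\<close> and along \<open>B\<close>, and the two results are combined.
\<close>

lemma symmetry_breaking_H:
  assumes G': "gl1_subgroup G \<tau> \<gg> ex G'"
    and \<eta>: "lifts_character G \<tau> \<gg> ex G' \<nu> \<eta>"
    and T: "symmetry_breaking_operator smul G' \<pi> \<eta> T"
  shows "T (d\<pi>C Hmat u) = \<nu> * T u"
proof -
  let ?\<hh> = "lie_subalgebra_of \<gg> ex G'"
  have lin: "Vector_Spaces.linear smul (*) T" and cont: "continuous_on UNIV T"
    and equiv: "x \<in> G' \<Longrightarrow> T (\<pi> x v) = \<eta> x * T v" for x v
    using T by (auto simp: symmetry_breaking_operator_def)
  interpret T: module_hom smul "(*)" T using lin by (simp add: linear_iff_module_hom)
  have range: "{A + cmat \<i> B | A B. A \<in> ?\<hh> \<and> B \<in> ?\<hh>} = range (\<lambda>c. cmat c Hmat)"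
    and sub: "subgroup G' G"
    using G' by (auto simp: gl1_subgroup_def)
  have zero: "0 \<in> ?\<hh>"
    using lie_zero subgroup.one_closed[OF sub] by (simp add: lie_subalgebra_of_def ex_zero)
  have multiple: "\<exists>c. A = cmat c Hmat" if "A \<in> ?\<hh>" for A
  proof -
    have "cmat \<i> 0 = 0" by (simp add: cmat_def vec_eq_iff)
    then have "A = A + cmat \<i> 0" by simp
    then have "A \<in> range (\<lambda>c. cmat c Hmat)" using range that zero by blast
    then show ?thesis by blast
  qed
  have T_dpi: "T (d\<pi> (cmat c Hmat) u) = \<nu> * c * T u" if "cmat c Hmat \<in> ?\<hh>" for c
  proof -
    let ?A = "cmat c Hmat"
    have A: "?A \<in> \<gg>" and mem: "ex (t *\<^sub>R ?A) \<in> G'" for t :: real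
      using that by (auto simp: lie_subalgebra_of_def)
    have "((\<lambda>t. T (rs (inverse t) (\<pi> (ex (t *\<^sub>R ?A)) u - u))) \<longlongrightarrow> T (d\<pi> ?A u)) (at 0)"
      using continuous_on_tendsto_compose[OF cont orbit_derivative[OF A]] by simp
    then have lim: "((\<lambda>t. of_real (inverse t) * (\<eta> (ex (t *\<^sub>R ?A)) * T u - T u)) \<longlongrightarrow>
        T (d\<pi> ?A u)) (at (0::real))"
      by (simp only: T.scale T.diff equiv[OF mem])
    have "((\<lambda>t::real. \<eta> (ex (t *\<^sub>R ?A))) has_vector_derivative \<nu> * c) (at 0)"
      and "\<eta> \<one>\<^bsub>G\<^esub> = 1"
      using \<eta> that by (auto simp: lifts_character_def)
    then have d: "((\<lambda>t::real. \<eta> (ex (t *\<^sub>R ?A))) has_derivative (\<lambda>t. t *\<^sub>R (\<nu> * c))) (at 0)"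
      and one: "\<eta> \<one>\<^bsub>G\<^esub> = 1"
      by (auto simp: has_vector_derivative_def)
    have "((\<lambda>t::real. inverse (norm t) *\<^sub>R
        (\<eta> (ex ((0 + t) *\<^sub>R ?A)) - \<eta> (ex ((0::real) *\<^sub>R ?A)) - t *\<^sub>R (\<nu> * c))) \<longlongrightarrow> 0) (at 0)"
      by (rule tendsto_norm_zero_cancel) (use d in \<open>simp add: has_derivative_at divide_inverse mult.commute\<close>)
    then have "((\<lambda>t::real. inverse t *\<^sub>R (\<eta> (ex (t *\<^sub>R ?A)) - 1)) \<longlongrightarrow> \<nu> * c) (at 0)"
      using difference_quotient_tendsto[of "\<lambda>t::real. \<eta> (ex (t *\<^sub>R ?A))" 0] by (simp add: ex_zero one)
    then have "((\<lambda>t::real. inverse t *\<^sub>R (\<eta> (ex (t *\<^sub>R ?A)) - 1) * T u) \<longlongrightarrow> \<nu> * c * T u) (at 0)"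
      by (rule tendsto_mult_right)
    moreover have "inverse t *\<^sub>R (\<eta> (ex (t *\<^sub>R ?A)) - 1) * T u =
        of_real (inverse t) * (\<eta> (ex (t *\<^sub>R ?A)) * T u - T u)" for t :: real
      unfolding scaleR_conv_of_real by (simp only: left_diff_distrib right_diff_distrib mult.assoc mult_1_left)
    ultimately show ?thesis using lim tendsto_unique[OF trivial_limit_at] by simp
  qed
  have "Hmat = cmat 1 Hmat" by (simp add: cmat_def vec_eq_iff)
  then obtain A B where AB: "A \<in> ?\<hh>" "B \<in> ?\<hh>" and H: "Hmat = A + cmat \<i> B"
    using range by blast
  obtain a b where a: "A = cmat a Hmat" and b: "B = cmat b Hmat" using multiple AB by blast
  have "Hmat $ 1 $ 1 = a * Hmat $ 1 $ 1 + \<i> * (b * Hmat $ 1 $ 1)"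
    using arg_cong[OF H, of "\<lambda>M. M $ 1 $ 1"] by (simp add: a b cmat_def)
  then have ab: "a + \<i> * b = 1" by (simp add: Hmat_def vector_2)
  have "A \<in> \<gg>" "B \<in> \<gg>" using AB by (auto simp: lie_subalgebra_of_def)
  then have "T (d\<pi>C Hmat u) = T (d\<pi> A u) + \<i> * T (d\<pi> B u)"
    unfolding H by (simp add: dpiC_decomposed T.add T.scale)
  also have "\<dots> = \<nu> * (a + \<i> * b) * T u"
    using T_dpi AB unfolding a b by (simp add: algebra_simps)
  finally show ?thesis by (simp add: ab)
qed

end

section \<open>Tensoring an sl(2)-module with the natural representation\<close>

lemma vector_space_tensor_scale:
  assumes "vector_space smul"
  shows "vector_space (tensor_scale smul)"
proof -
  interpret vector_space smul by fact
  show ?thesis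
    by unfold_locales (simp_all add: tensor_scale_def vec_eq_iff scale_left_distrib scale_right_distrib)
qed

lemma center_act_generator:
  assumes "vector_space s"
  shows "center_act s act [:0, 1:] w = casimir s act w"
proof -
  interpret vector_space s by fact
  show ?thesis by (simp add: center_act_def)
qed

lemma center_act_eigenvector:
  assumes lin: "Vector_Spaces.linear s s (casimir s act)" and w: "casimir s act w = s c w"
  shows "center_act s act z w = s (poly z c) w"
proof -
  interpret Vector_Spaces.linear s s "casimir s act" by fact
  have "(casimir s act ^^ i) w = s (c ^ i) w" for i
    by (induction i) (simp_all add: scale w mult.commute)
  then show ?thesis
    by (simp add: center_act_def poly_altdef vs1.scale_sum_left)
qed

text \<open>
  On the primary component the Casimir element is a scalar \<open>c\<close>, and some power of
  \<open>c - (\<tau>\<^sup>2 - 1)\<close> annihilates each vector, so \<open>c = \<tau>\<^sup>2 - 1\<close> unless the component is zero.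
\<close>

lemma primary_component_eq_eigenspace:
  assumes lin: "Vector_Spaces.linear s s (casimir s act)"
    and scalar: "center_acts_by_scalars s act (primary_component s act \<tau>)"
  shows "primary_component s act \<tau> = {w. casimir s act w = s (\<tau>\<^sup>2 - 1) w}"
proof (intro equalityI subsetI)
  interpret Vector_Spaces.linear s s "casimir s act" by fact
  note gen = center_act_generator[OF vs1.vector_space_axioms]
  {
    fix w assume w: "w \<in> primary_component s act \<tau>"
    let ?h = "\<tau>\<^sup>2 - 1"
    obtain c where c: "casimir s act w = s c w"
      using scalar w unfolding center_acts_by_scalars_def by (metis gen)
    obtain n where n: "((\<lambda>v. casimir s act v - s ?h v) ^^ n) w = 0"
      using w unfolding primary_component_def
      by (auto simp: hc_character_def gen dest!: spec[of _ "[:0, 1:]"])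
    have "((\<lambda>v. casimir s act v - s ?h v) ^^ n) w = s ((c - ?h) ^ n) w"
    proof (induction n)
      case (Suc n)
      then show ?case by (simp add: scale c vs1.scale_left_diff_distrib algebra_simps)
    qed simp
    then have "s ((c - ?h) ^ n) w = 0" using n by simp
    then have "c = ?h \<or> w = 0" by (auto simp: vs1.scale_eq_0_iff)
    then show "w \<in> {w. casimir s act w = s ?h w}" using c by auto
  next
    fix w assume "w \<in> {w. casimir s act w = s (\<tau>\<^sup>2 - 1) w}"
    then have "center_act s act z w = s (hc_character \<tau> z) w" for z
      using center_act_eigenvector[OF lin] by (simp add: hc_character_def)
    then have "((\<lambda>v. center_act s act z v - s (hc_character \<tau> z) v) ^^ 1) w = 0" for z
      by simp
    then show "w \<in> primary_component s act \<tau>" unfolding primary_component_def by blast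
  }
qed

text \<open>
  The quadratic equation for the Casimir element \<open>C\<close> has the roots
  \<open>p = \<lambda>\<^sup>2 + 2\<lambda>d = (\<lambda> + d)\<^sup>2 - 1\<close> and \<open>m = \<lambda>\<^sup>2 - 2\<lambda>d = (\<lambda> - d)\<^sup>2 - 1\<close>.
  The projection to the \<open>p\<close>-eigenspace along the \<open>m\<close>-eigenspace is \<open>(C - m) / (p - m)\<close>,
  with \<open>p - m = 4\<lambda>d\<close>.
\<close>

lemma pr_primary_eq:
  assumes lin: "Vector_Spaces.linear s s (casimir s act)"
    and quadratic: "\<And>w. casimir s act (casimir s act w) =
      s (2 * lam\<^sup>2) (casimir s act w) + s (4 * lam\<^sup>2 - lam ^ 4) w"
    and lam: "lam \<noteq> 0" and d: "d\<^sup>2 = (1::complex)"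
    and scalar: "center_acts_by_scalars s act (primary_component s act (lam + d))"
      "center_acts_by_scalars s act (primary_component s act (lam - d))"
  shows "pr_primary s act lam d w =
    s (1 / (4 * lam * d)) (casimir s act w - s (lam\<^sup>2 - 2 * lam * d) w)"
proof -
  interpret Vector_Spaces.linear s s "casimir s act" by fact
  let ?C = "casimir s act" and ?p = "lam\<^sup>2 + 2 * lam * d" and ?m = "lam\<^sup>2 - 2 * lam * d"
  let ?k = "1 / (4 * lam * d)"
  let ?w = "s ?k (?C w - s ?m w)"
  have d0: "d \<noteq> 0" using d by auto
  have hc: "(lam + d)\<^sup>2 - 1 = ?p" "(lam - d)\<^sup>2 - 1 = ?m"
    using d by (simp_all add: power2_eq_square algebra_simps)
  have P: "primary_component s act (lam + d) = {w. ?C w = s ?p w}"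
    "primary_component s act (lam - d) = {w. ?C w = s ?m w}"
    using primary_component_eq_eigenspace[OF lin scalar(1)]
      primary_component_eq_eigenspace[OF lin scalar(2)] unfolding hc .
  have prod: "?p * ?m = lam ^ 4 - 4 * lam\<^sup>2"
  proof -
    have "?p * ?m = lam ^ 4 - 4 * lam\<^sup>2 * d\<^sup>2" by algebra
    then show ?thesis using d by simp
  qed
  have CC: "?C (?C w) = s (?p + ?m) (?C w) - s (?p * ?m) w"
    unfolding quadratic prod by (simp add: vs1.scale_left_diff_distrib algebra_simps)
  have root: "?C (s k (?C w - s m w)) = s q (s k (?C w - s m w))"
    if "?C (?C w) = s (q + m) (?C w) - s (q * m) w" for k q m
    by (simp add: scale diff that vs1.scale_left_distrib vs1.scale_right_distrib
        vs1.scale_right_diff_distrib mult_ac)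
  have k: "?k * ?p - ?k * ?m = 1" using lam d0 by (simp add: field_simps)
  show ?thesis unfolding pr_primary_def P mem_Collect_eq
  proof (rule the_equality, intro conjI)
    show "?C ?w = s ?p ?w" by (rule root[OF CC])
    have "s (k * q - k * m) w - s k (v - s m w) = s (- k) (v - s q w)" for k q m v
      by (simp add: vs1.scale_left_diff_distrib vs1.scale_right_diff_distrib)
    from this[of ?k ?p ?m "?C w"] have "w - ?w = s (- ?k) (?C w - s ?p w)"
      unfolding k vs1.scale_one .
    moreover have "?C (s (- ?k) (?C w - s ?p w)) = s ?m (s (- ?k) (?C w - s ?p w))"
      by (rule root) (use CC in \<open>simp only: add.commute mult.commute\<close>)
    ultimately show "?C (w - ?w) = s ?m (w - ?w)" by simp
  next
    fix w' assume w': "?C w' = s ?p w' \<and> ?C (w - w') = s ?m (w - w')"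
    have "s q w' + s m (w - w') - s m w = s (q - m) w'" for q m
      by (simp add: vs1.scale_left_diff_distrib vs1.scale_right_diff_distrib)
    moreover have "?C w = ?C w' + ?C (w - w')" by (simp flip: add)
    ultimately have "?C w - s ?m w = s (?p - ?m) w'" using w' by metis
    then have "?w = s (?k * ?p - ?k * ?m) w'" by (simp only: vs1.scale_scale right_diff_distrib)
    then show "w' = ?w" unfolding k by simp
  qed
qed

lemma tensor_act_sl2_triple:
  assumes "vector_space smul"
  shows "tensor_act smul act Hmat w = vector [act Hmat (w $ 1) + w $ 1, act Hmat (w $ 2) - w $ 2]"
    "tensor_act smul act Xmat w = vector [act Xmat (w $ 1) + w $ 2, act Xmat (w $ 2)]"
    "tensor_act smul act Ymat w = vector [act Ymat (w $ 1), act Ymat (w $ 2) + w $ 1]"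
proof -
  interpret vector_space smul by fact
  show "tensor_act smul act Hmat w = vector [act Hmat (w $ 1) + w $ 1, act Hmat (w $ 2) - w $ 2]"
    "tensor_act smul act Xmat w = vector [act Xmat (w $ 1) + w $ 2, act Xmat (w $ 2)]"
    "tensor_act smul act Ymat w = vector [act Ymat (w $ 1), act Ymat (w $ 2) + w $ 1]"
    by (simp_all add: tensor_act_def tensor_def vec_eq_iff forall_2 sum_2 axis_def
        matrix_vector_mult_def Hmat_def Xmat_def Ymat_def vector_2)
qed

text \<open>
  The relations of the \<open>sl(2)\<close>-triple are stated in a form that moves \<open>H\<close> to the right of \<open>X\<close> and \<open>Y\<close>,
  and \<open>X\<close> to the right of \<open>Y\<close>, so that they terminate as rewrite rules.
\<close>

locale sl2_module = vector_space smul
  for smul :: "complex \<Rightarrow> 'v::ab_group_add \<Rightarrow> 'v" +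
  fixes act :: "mat2 \<Rightarrow> 'v \<Rightarrow> 'v" and lam :: complex
  assumes linear_H: "Vector_Spaces.linear smul smul (act Hmat)"
    and linear_X: "Vector_Spaces.linear smul smul (act Xmat)"
    and linear_Y: "Vector_Spaces.linear smul smul (act Ymat)"
    and HX: "act Hmat (act Xmat u) = act Xmat (act Hmat u) + smul 2 (act Xmat u)"
    and HY: "act Hmat (act Ymat u) = act Ymat (act Hmat u) - smul 2 (act Ymat u)"
    and XY: "act Xmat (act Ymat u) = act Ymat (act Xmat u) + act Hmat u"
    and casimir: "casimir smul act u = smul (lam\<^sup>2 - 1) u"
begin

sublocale H: module_hom smul smul "act Hmat"
  using linear_H by (simp add: linear_iff_module_hom)
sublocale X: module_hom smul smul "act Xmat"
  using linear_X by (simp add: linear_iff_module_hom)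
sublocale Y: module_hom smul smul "act Ymat"
  using linear_Y by (simp add: linear_iff_module_hom)

abbreviation scale2 :: "complex \<Rightarrow> 'v^2 \<Rightarrow> 'v^2" where "scale2 \<equiv> tensor_scale smul"
abbreviation act2 :: "mat2 \<Rightarrow> 'v^2 \<Rightarrow> 'v^2" where "act2 \<equiv> tensor_act smul act"

text \<open>
  Writing numeral multiples as sums reduces the identities below to computations in an abelian group.
\<close>

lemma scale_numerals: "smul 2 u = u + u" "smul 4 u = u + u + (u + u)"
proof -
  show two: "smul 2 u = u + u" for u using scale_left_distrib[of 1 1 u] by simp
  show "smul 4 u = u + u + (u + u)" using scale_left_distrib[of 2 2 u] by (simp add: two)
qed

text \<open>
  The Casimir relation solved for \<open>H\<^sup>2\<close>; together with the commutation relations it gives a normal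
  form for words of length two in \<open>H\<close>, \<open>X\<close>, \<open>Y\<close>.
\<close>

lemma H_squared:
  "act Hmat (act Hmat u) = smul (lam\<^sup>2) u - u - (smul 4 (act Ymat (act Xmat u)) + smul 2 (act Hmat u))"
  using casimir[of u]
  by (simp add: casimir_def XY scale_numerals scale_left_diff_distrib algebra_simps)

text \<open>
  The operator \<open>K = 2 (N + 1)\<close> with \<open>N\<close> the operator matrix with rows \<open>(H, 2Y)\<close> and \<open>(2X, -H)\<close>.
\<close>

definition shifted_casimir :: "'v^2 \<Rightarrow> 'v^2" where
  "shifted_casimir w = vector
     [smul 2 (w $ 1 + act Hmat (w $ 1) + smul 2 (act Ymat (w $ 2))),
      smul 2 (w $ 2 - act Hmat (w $ 2) + smul 2 (act Xmat (w $ 1)))]"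

lemma casimir_tensor: "casimir scale2 act2 w = scale2 (lam\<^sup>2) w + shifted_casimir w"
  unfolding casimir_def[of scale2] tensor_act_sl2_triple[OF vector_space_axioms] shifted_casimir_def
  by (simp add: tensor_scale_def vec_eq_iff forall_2 vector_2 H.add H.diff X.add Y.add X.diff
      H_squared XY scale_numerals algebra_simps)

text \<open>
  On the diagonal, \<open>H\<^sup>2 + 4YX = \<Omega> - 2H\<close> and \<open>H\<^sup>2 + 4XY = \<Omega> + 2H\<close>; off the diagonal, \<open>HY - YH = -2Y\<close>
  and \<open>XH - HX = -2X\<close>.  Hence \<open>N\<^sup>2 = \<Omega> - 2N\<close> and \<open>(N + 1)\<^sup>2 = \<Omega> + 1 = \<lambda>\<^sup>2\<close>.
\<close>

lemma shifted_casimir_squared: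
  "shifted_casimir (shifted_casimir w) = scale2 (4 * lam\<^sup>2) w"
proof -
  have "smul (4 * lam\<^sup>2) u = smul 4 (smul (lam\<^sup>2) u)" for u by simp
  then show ?thesis
    unfolding shifted_casimir_def
    by (simp only: tensor_scale_def vec_eq_iff forall_2 vector_2 vec_lambda_beta scale_numerals
        H.add H.diff X.add X.diff Y.add Y.diff HX HY XY H_squared)
      (simp add: algebra_simps)
qed

lemma linear_shifted_casimir: "Vector_Spaces.linear scale2 scale2 shifted_casimir"
proof -
  have "shifted_casimir (v + w) = shifted_casimir v + shifted_casimir w" for v w
    unfolding shifted_casimir_def
    by (simp add: vec_eq_iff forall_2 vector_2 H.add X.add Y.add scale_numerals algebra_simps)
  moreover have "shifted_casimir (scale2 c w) = scale2 c (shifted_casimir w)" for c w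
    unfolding shifted_casimir_def
    by (simp add: tensor_scale_def vec_eq_iff forall_2 vector_2 H.scale X.scale Y.scale
        scale_right_distrib scale_right_diff_distrib mult.commute)
  ultimately show ?thesis
    using vector_space_tensor_scale[OF vector_space_axioms] by (simp add: Vector_Spaces.linear_iff)
qed

lemma linear_casimir_tensor: "Vector_Spaces.linear scale2 scale2 (casimir scale2 act2)"
proof -
  interpret W: vector_space scale2 by (rule vector_space_tensor_scale[OF vector_space_axioms])
  interpret K: module_hom scale2 scale2 shifted_casimir
    using linear_shifted_casimir by (simp add: linear_iff_module_hom)
  show ?thesis
    using W.vector_space_axioms
    by (simp add: Vector_Spaces.linear_iff casimir_tensor K.add K.scale W.scale_right_distrib mult.commute
        add_ac)
qed

lemma casimir_tensor_quadratic:
  "casimir scale2 act2 (casimir scale2 act2 w) =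
     scale2 (2 * lam\<^sup>2) (casimir scale2 act2 w) + scale2 (4 * lam\<^sup>2 - lam ^ 4) w"
proof -
  interpret W: vector_space scale2 by (rule vector_space_tensor_scale[OF vector_space_axioms])
  interpret K: module_hom scale2 scale2 shifted_casimir
    using linear_shifted_casimir by (simp add: linear_iff_module_hom)
  let ?K = shifted_casimir
  have "casimir scale2 act2 (casimir scale2 act2 w) =
      scale2 (lam\<^sup>2) (scale2 (lam\<^sup>2) w) + scale2 (lam\<^sup>2) (?K w) + (scale2 (lam\<^sup>2) (?K w) + ?K (?K w))"
    unfolding casimir_tensor K.add K.scale W.scale_right_distrib by simp
  also have "?K (?K w) = scale2 (4 * lam\<^sup>2) w" by (rule shifted_casimir_squared)
  also have "scale2 (lam\<^sup>2) (scale2 (lam\<^sup>2) w) + scale2 (lam\<^sup>2) (?K w) +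
        (scale2 (lam\<^sup>2) (?K w) + scale2 (4 * lam\<^sup>2) w) =
      scale2 (lam\<^sup>2 * lam\<^sup>2 + 4 * lam\<^sup>2) w + scale2 (lam\<^sup>2 + lam\<^sup>2) (?K w)"
    by (simp only: W.scale_left_distrib W.scale_scale add_ac)
  also have "lam\<^sup>2 * lam\<^sup>2 + 4 * lam\<^sup>2 = 2 * lam\<^sup>2 * lam\<^sup>2 + (4 * lam\<^sup>2 - lam ^ 4)" by algebra
  also have "lam\<^sup>2 + lam\<^sup>2 = 2 * lam\<^sup>2" by simp
  also have "scale2 (2 * lam\<^sup>2 * lam\<^sup>2 + (4 * lam\<^sup>2 - lam ^ 4)) w + scale2 (2 * lam\<^sup>2) (?K w) =
      scale2 (2 * lam\<^sup>2) (casimir scale2 act2 w) + scale2 (4 * lam\<^sup>2 - lam ^ 4) w"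
    by (simp only: casimir_tensor W.scale_left_distrib W.scale_right_distrib W.scale_scale add_ac)
  finally show ?thesis .
qed

text \<open>
  Of the operator matrix \<open>K\<close> only the diagonal entry \<open>2 (1 + \<epsilon>H)\<close> contributes to the component of the
  projection along \<open>f\<^sub>\<epsilon>\<close>, and \<open>T\<close> evaluates it by \<open>T (H u) = \<nu> T u\<close>.
\<close>

lemma pr_primary_tensor_component:
  assumes T: "Vector_Spaces.linear smul (*) T" and TH: "T (act Hmat u) = \<nu> * T u"
    and lam: "lam \<noteq> 0" and e: "\<epsilon> \<in> {1, -1}" and d: "\<delta> \<in> {1, -1}"
    and scalar: "center_acts_by_scalars scale2 act2 (primary_component scale2 act2 (lam + 1))"
      "center_acts_by_scalars scale2 act2 (primary_component scale2 act2 (lam - 1))"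
  shows "tensor_map T (pr_line \<epsilon>) (pr_primary scale2 act2 lam (of_int \<delta>) (tensor smul u (fbasis \<epsilon>)))
       = ((lam + of_int \<delta> * (1 + of_int \<epsilon> * \<nu>)) / (2 * lam)) *s tensor (*) (T u) (fbasis \<epsilon>)"
proof -
  interpret T: module_hom smul "(*)" T using T by (simp add: linear_iff_module_hom)
  let ?d = "of_int \<delta> :: complex"
  have d2: "?d\<^sup>2 = 1" using d by auto
  then have d0: "?d \<noteq> 0" by auto
  have sc: "center_acts_by_scalars scale2 act2 (primary_component scale2 act2 (lam + ?d))"
    "center_acts_by_scalars scale2 act2 (primary_component scale2 act2 (lam - ?d))"
    using scalar d by auto
  note pr = pr_primary_eq[OF linear_casimir_tensor casimir_tensor_quadratic lam d2 sc]
  let ?r = "(lam + ?d * (1 + of_int \<epsilon> * \<nu>)) / (2 * lam)"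
  have r: "1 / (4 * lam * ?d) * (lam\<^sup>2 * t + 2 * (t + of_int \<epsilon> * (\<nu> * t)) - (lam\<^sup>2 - 2 * lam * ?d) * t) =
      ?r * t" for t
    using d lam by (auto simp: field_simps power2_eq_square)
  define i :: 2 where "i = (if \<epsilon> = 1 then 1 else 2)"
  let ?w = "tensor smul u (fbasis \<epsilon>)"
  have w: "?w $ i = u" by (simp add: i_def tensor_def fbasis_def axis_def)
  have "casimir scale2 act2 ?w $ i = smul (lam\<^sup>2) u + smul 2 (u + smul (of_int \<epsilon>) (act Hmat u))"
    using e by (auto simp: casimir_tensor i_def tensor_scale_def shifted_casimir_def tensor_def
        fbasis_def axis_def vector_2)
  then have "T (pr_primary scale2 act2 lam ?d ?w $ i) =
      1 / (4 * lam * ?d) * (lam\<^sup>2 * T u + 2 * (T u + of_int \<epsilon> * (\<nu> * T u)) - (lam\<^sup>2 - 2 * lam * ?d) * T u)"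
    unfolding pr tensor_scale_def vector_minus_component vec_lambda_beta w
    by (simp only: T.add T.diff T.scale TH)
  then have "T (pr_primary scale2 act2 lam ?d ?w $ i) = ?r * T u" unfolding r .
  then show ?thesis
    using e by (auto simp: i_def tensor_map_def sum_2 pr_line_def fbasis_def tensor_def vec_eq_iff
        forall_2 axis_def)
qed

end

section \<open>Symmetry breaking operators under translation\<close>

context smooth_rep
begin

lemma dpiC_sl2_module:
  assumes "has_inf_character smul d\<pi>C lam"
  shows "sl2_module smul d\<pi>C lam"
proof -
  have mem: "Hmat \<in> sl2" "Xmat \<in> sl2" "Ymat \<in> sl2"
    by (simp_all add: sl2_def trace_def sum_2 Hmat_def Xmat_def Ymat_def vector_2)
  have "d\<pi>C Hmat (d\<pi>C Xmat u) - d\<pi>C Xmat (d\<pi>C Hmat u) = smul 2 (d\<pi>C Xmat u)" for u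
    using dpiC_commutator[OF mem(1,2)] dpiC_scaleR[OF mem(2), of 2] by (simp add: sl2_triple)
  moreover have "d\<pi>C Hmat (d\<pi>C Ymat u) - d\<pi>C Ymat (d\<pi>C Hmat u) = - smul 2 (d\<pi>C Ymat u)" for u
    using dpiC_commutator[OF mem(1,3)] dpiC_scaleR[OF mem(3), of "-2"] by (simp add: sl2_triple)
  moreover have "d\<pi>C Xmat (d\<pi>C Ymat u) - d\<pi>C Ymat (d\<pi>C Xmat u) = d\<pi>C Hmat u" for u
    using dpiC_commutator[OF mem(2,3)] by (simp add: sl2_triple)
  moreover have "casimir smul d\<pi>C u = smul (lam\<^sup>2 - 1) u" for u
    using assms center_act_generator[OF vector_space_axioms, of d\<pi>C u]
    by (metis has_inf_character_def hc_character_def poly_pCons poly_0 mult_zero_right add_0 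
        add.right_neutral mult.right_neutral)
  ultimately show ?thesis
    using vector_space_axioms dpiC_linear mem
    by (simp add: sl2_module_def sl2_module_axioms_def algebra_simps)
qed

end

lemma in_category_M_smooth_rep:
  assumes "reductive_sl2_group G \<tau> \<A> \<gg> ex" "in_category_M smul G \<tau> \<A> \<gg> ex \<pi>"
  obtains p where "smooth_rep smul p G \<tau> \<A> \<gg> ex \<pi>"
proof -
  obtain p where "frechet smul p"
    using assms(2) frechet_space_seminorms unfolding in_category_M_def by blast
  then have "smooth_rep smul p G \<tau> \<A> \<gg> ex \<pi>"
    using assms unfolding smooth_rep_def smooth_rep_axioms_def reductive_sl2_group_def in_category_M_def
    by simp
  then show thesis by (rule that)
qed

theorem theorem2p3:
  fixes G :: "'g monoid" and \<tau> :: "'g topology" and \<A> :: "('g, 'e::euclidean_space) atlas"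
    and \<gg> :: "mat2 set" and ex :: "mat2 \<Rightarrow> 'g" and G' :: "'g set"
    and smul :: "complex \<Rightarrow> 'v::{t2_space,ab_group_add} \<Rightarrow> 'v" and \<pi> :: "'g \<Rightarrow> 'v \<Rightarrow> 'v"
    and lam \<nu> :: complex and \<eta> :: "'g \<Rightarrow> complex" and T :: "'v \<Rightarrow> complex"
    and \<epsilon> \<delta> :: int and u :: 'v
  defines "act \<equiv> dpiC smul \<gg> ex \<pi>"
  defines "act2 \<equiv> tensor_act smul act"
    and "scale2 \<equiv> tensor_scale smul"
  assumes G: "reductive_sl2_group G \<tau> \<A> \<gg> ex"
    and G': "gl1_subgroup G \<tau> \<gg> ex G'"
    and \<Pi>: "in_category_M smul G \<tau> \<A> \<gg> ex \<pi>"
    and inf_char: "has_inf_character smul act lam"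
    and nonsingular: "lam \<noteq> 0"
    and scalars_plus: "center_acts_by_scalars scale2 act2 (primary_component scale2 act2 (lam + 1))"
    and scalars_minus: "center_acts_by_scalars scale2 act2 (primary_component scale2 act2 (lam - 1))"
    and \<epsilon>: "\<epsilon> \<in> {1, -1}"
    and \<delta>: "\<delta> \<in> {1, -1}"
    and \<eta>: "lifts_character G \<tau> \<gg> ex G' \<nu> \<eta>"
    and T: "symmetry_breaking_operator smul G' \<pi> \<eta> T"
  shows "tensor_map T (pr_line \<epsilon>) (pr_primary scale2 act2 lam (of_int \<delta>) (tensor smul u (fbasis \<epsilon>)))
       = ((lam + of_int \<delta> * (1 + of_int \<epsilon> * \<nu>)) / (2 * lam)) *s tensor (*) (T u) (fbasis \<epsilon>)"
proof -
  obtain p where "smooth_rep smul p G \<tau> \<A> \<gg> ex \<pi>"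
    by (rule in_category_M_smooth_rep[OF G \<Pi>])
  then interpret smooth_rep smul p G \<tau> \<A> \<gg> ex \<pi> .
  interpret sl2_module smul act lam
    using dpiC_sl2_module inf_char unfolding act_def .
  have "Vector_Spaces.linear smul (*) T" using T by (simp add: symmetry_breaking_operator_def)
  moreover have "T (act Hmat u) = \<nu> * T u"
    unfolding act_def by (rule symmetry_breaking_H[OF G' \<eta> T])
  ultimately show ?thesis
    using nonsingular \<epsilon> \<delta> scalars_plus scalars_minus
    unfolding act2_def scale2_def by (rule pr_primary_tensor_component)
qed

end
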